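(* Let $\mathbf E^1,\dots,\mathbf E^N$ be calibration residual trajectories in $\mathbb R^{nH}$ satisfying the conditional trajectory sampling assumption stated in the context (i.i.d. together with any finite number of fresh trajectories), and let $V_N=\mathbb P\{\mathbf E\notin\mathcal E_{\hat\theta_N}\mid S_N\}$ be the conditional violation risk of the calibrated tube $\mathcal E_{\hat\theta_N}$, $\hat\theta_N=A(S_N)$, $S_N=(\mathbf E^1,\dots,\mathbf E^N)$. (i) If the tube calibrator is a proper collective tube boundary scheme with boundary size $s\in\{1,\dots,N\}$, then $$V_N\sim \mathrm{Beta}(s,N-s+1).$$ Equivalently, for every $\varepsilon\in[0,1]$, $$\mathbb P^N\{V_N>\varepsilon\}=B_{N,s}(\varepsilon):=\sum_{j=0}^{s-1}\binom Nj\varepsilon^j(1-\varepsilon)^{N-j}.$$ Consequently $\mathbb P^N\{V_N\le \varepsilon_{N,s}(\beta)\}\ge 1-\beta$, where $\varepsilon_{N,s}(\beta):=\inf\{\varepsilon\in[0,1]:B_{N,s}(\varepsilon)\le\beta\}$. (ii) If the calibrator has certified boundary complexity at most $\bar s\in\{1,\dots,N\}$, then for every $\varepsilon\in[0,1]$ $$\mathbb P^N\{V_N>\varepsilon\}\le B_{N,\bar s}(\varepsilon),$$ and consequently $\mathbb P^N\{V_N\le\varepsilon_{N,\bar s}(\beta)\}\ge1-\beta$.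
   Context: A tube family is a family of measurable sets $\mathcal E_\theta\subseteq\mathbb R^{nH}$, $\theta\in\Theta$. A tube calibrator $A$ maps any finite tuple of trajectories in $\mathbb R^{nH}$ to a parameter $\theta\in\Theta$. For a deterministic collection $T_n=(\mathbf e^1,\dots,\mathbf e^n)$ of trajectories and an index set $I\subset[n]=\{1,\dots,n\}$, $T_I$ is the subcollection indexed by $I$ and $\mathcal E(T_I):=\mathcal E_{A(T_I)}$. A boundary map assigns to each $T_n$ a set $\mathcal B_n(T_n)\subset[n]$. Sampling assumption: the model, tube family and all tuning choices are fixed before the calibration data are used; conditional on this training/tuning information and on the online information pattern (all probabilities below are under this conditioning, which is suppressed in the notation), $\mathbf E^1,\dots,\mathbf E^N$ and any finite number of fresh residual trajectories are independent and identically distributed. $\mathbf E$ denotes a fresh trajectory. $\mathbb P^N$ is the law of the calibration sample $S_N$. Ties have probability zero (or are broken by an independent continuous tie-breaker). $\beta\in(0,1)$. Proper collective tube boundary scheme with size $s$: outside null tie events, for every $n\ge s$, every deterministic $T_n$, and every split $I\subset[n]$ with $|I|\ge s$, $J=[n]\setminus I$: 1) (Boundary equivalence) $\mathbf e^j\in\mathcal E(T_I)$ for all $j\in J$ if and only if $\mathcal B_n(T_n)\subseteq I$. 2) (Projectivity) If $\mathcal B_n(T_n)\subseteq I$, then $\mathcal B_{|I|}(T_I)=\mathcal B_n(T_n)$ after relabeling. 3) (Fixed boundary size) $|\mathcal B_n(T_n)|=s$. The calibrator has certified boundary complexity at most $\bar s$ if items 1)–2) hold (with $n\ge\bar s$ and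 $|I|\ge\bar s$) and item 3) is replaced by $|\mathcal B_n(T_n)|\le\bar s$ for all $n$ and all deterministic samples $T_n$; $\bar s$ is a structural upper bound fixed by the calibration rule. *)

theory Defs
  imports "HOL-Probability.Probability"
begin

text \<open>
  Trajectories live in a Euclidean space \<open>'a\<close>, to be read as \<open>\<real>\<^sup>n\<^sup>H\<close> with \<open>DIM('a)\<close> equal to the product
  of the state dimension and the horizon, e.g. \<open>real ^ 'n ^ 'h\<close>.  If ties are broken by an independent
  continuous variable, \<open>'a\<close> is that space times \<open>real\<close>, each trajectory carrying its tie-breaker.
  Finite tuples are lists, so the index set \<open>[n]\<close> is \<open>{..<n}\<close> and \<open>T\<^sub>I\<close> is \<open>nths T I\<close>.
\<close>

definition tube_family :: "'t set \<Rightarrow> ('t \<Rightarrow> 'a::euclidean_space set) \<Rightarrow> bool" where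
  "tube_family \<Theta> E \<longleftrightarrow> (\<forall>\<theta>\<in>\<Theta>. E \<theta> \<in> sets borel)"

text \<open>
  The second conjunct is the usual tacit regularity: membership of a fresh trajectory in the tube
  calibrated on \<open>n\<close> trajectories is an event, so that its (conditional) probability makes sense.
\<close>

definition tube_calibrator ::
  "'t set \<Rightarrow> ('t \<Rightarrow> 'a::euclidean_space set) \<Rightarrow> ('a list \<Rightarrow> 't) \<Rightarrow> bool" where
  "tube_calibrator \<Theta> E A \<longleftrightarrow>
     (\<forall>T. A T \<in> \<Theta>) \<and>
     (\<forall>n. {p \<in> space ((\<Pi>\<^sub>M i\<in>{..<n}. borel) \<Otimes>\<^sub>M borel). snd p \<in> E (A (map (fst p) [0..<n]))}
            \<in> sets ((\<Pi>\<^sub>M i\<in>{..<n}. borel) \<Otimes>\<^sub>M borel))"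

definition boundary_map :: "('a list \<Rightarrow> nat set) \<Rightarrow> bool" where
  "boundary_map B \<longleftrightarrow> (\<forall>T. B T \<subseteq> {..<length T})"

text \<open>
  \<open>X 0, \<dots>, X (N - 1)\<close> are the calibration trajectories and \<open>X N, X (N + 1), \<dots>\<close> fresh ones.
  Independence over \<open>UNIV\<close> means independence of every finite subfamily.  The measure \<open>M\<close> is the
  conditional probability given the training, tuning and online information.
\<close>

definition iid_trajectories :: "'w measure \<Rightarrow> (nat \<Rightarrow> 'w \<Rightarrow> 'a::euclidean_space) \<Rightarrow> bool" where
  "iid_trajectories M X \<longleftrightarrow>
     prob_space.indep_vars M (\<lambda>_. borel) X UNIV \<and>
     (\<forall>i. distr M borel (X i) = distr M borel (X 0))"

definition sample :: "(nat \<Rightarrow> 'w \<Rightarrow> 'a) \<Rightarrow> nat \<Rightarrow> 'w \<Rightarrow> 'a list" where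
  "sample X n \<omega> = map (\<lambda>i. X i \<omega>) [0..<n]"

definition boundary_equivalence ::
  "('t \<Rightarrow> 'a set) \<Rightarrow> ('a list \<Rightarrow> 't) \<Rightarrow> ('a list \<Rightarrow> nat set) \<Rightarrow> 'a list \<Rightarrow> nat set \<Rightarrow> bool" where
  "boundary_equivalence E A B T I \<longleftrightarrow>
     ((\<forall>j\<in>{..<length T} - I. T ! j \<in> E (A (nths T I))) \<longleftrightarrow> B T \<subseteq> I)"

text \<open>
  Position \<open>k\<close> of \<open>nths T I\<close> is position \<open>sorted_list_of_set I ! k\<close> of \<open>T\<close>; this is the relabeling.
\<close>

definition projectivity :: "('a list \<Rightarrow> nat set) \<Rightarrow> 'a list \<Rightarrow> nat set \<Rightarrow> bool" where
  "projectivity B T I \<longleftrightarrow>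
     (B T \<subseteq> I \<longrightarrow> (\<lambda>k. sorted_list_of_set I ! k) ` B (nths T I) = B T)"

text \<open>
  \<open>P\<close> is the law of one trajectory.  ``Outside null tie events'' is rendered by requiring the
  properties for almost every \<open>n\<close>-tuple under the product law \<open>P\<^sup>n\<close>; the exceptional null set does
  not depend on the split.
\<close>

definition proper_boundary_scheme ::
  "'a measure \<Rightarrow> ('t \<Rightarrow> 'a set) \<Rightarrow> ('a list \<Rightarrow> 't) \<Rightarrow> ('a list \<Rightarrow> nat set) \<Rightarrow> nat \<Rightarrow> bool" where
  "proper_boundary_scheme P E A B s \<longleftrightarrow>
     (\<forall>n\<ge>s. AE f in (\<Pi>\<^sub>M i\<in>{..<n}. P). \<forall>I\<subseteq>{..<n}. s \<le> card I \<longrightarrow>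
        boundary_equivalence E A B (map f [0..<n]) I \<and>
        projectivity B (map f [0..<n]) I \<and>
        card (B (map f [0..<n])) = s)"

definition certified_boundary_complexity ::
  "'a measure \<Rightarrow> ('t \<Rightarrow> 'a set) \<Rightarrow> ('a list \<Rightarrow> 't) \<Rightarrow> ('a list \<Rightarrow> nat set) \<Rightarrow> nat \<Rightarrow> bool" where
  "certified_boundary_complexity P E A B s \<longleftrightarrow>
     (\<forall>n\<ge>s. AE f in (\<Pi>\<^sub>M i\<in>{..<n}. P). \<forall>I\<subseteq>{..<n}. s \<le> card I \<longrightarrow>
        boundary_equivalence E A B (map f [0..<n]) I \<and>
        projectivity B (map f [0..<n]) I) \<and>
     (\<forall>T. card (B T) \<le> s)"

definition sample_algebra :: "'w measure \<Rightarrow> (nat \<Rightarrow> 'w \<Rightarrow> 'a::euclidean_space) \<Rightarrow> nat \<Rightarrow> 'w measure" where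
  "sample_algebra M X N =
     vimage_algebra (space M) (\<lambda>\<omega>. \<lambda>i\<in>{..<N}. X i \<omega>) (\<Pi>\<^sub>M i\<in>{..<N}. borel)"

text \<open>The conditional probability, given the calibration sample, that the fresh \<open>X N\<close> leaves the tube.\<close>

definition violation_risk ::
  "'w measure \<Rightarrow> (nat \<Rightarrow> 'w \<Rightarrow> 'a::euclidean_space) \<Rightarrow> ('t \<Rightarrow> 'a set) \<Rightarrow> ('a list \<Rightarrow> 't) \<Rightarrow> nat \<Rightarrow>
   'w \<Rightarrow> real" where
  "violation_risk M X E A N =
     real_cond_exp M (sample_algebra M X N)
       (indicator {\<omega> \<in> space M. X N \<omega> \<notin> E (A (sample X N \<omega>))})"

definition beta_density :: "real \<Rightarrow> real \<Rightarrow> real \<Rightarrow> real" where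
  "beta_density a b x =
     (if 0 < x \<and> x < 1 then x powr (a - 1) * (1 - x) powr (b - 1) / Beta a b else 0)"

definition binomial_tail :: "nat \<Rightarrow> nat \<Rightarrow> real \<Rightarrow> real" where
  "binomial_tail N s \<epsilon> = (\<Sum>j<s. real (N choose j) * \<epsilon> ^ j * (1 - \<epsilon>) ^ (N - j))"

definition risk_level :: "nat \<Rightarrow> nat \<Rightarrow> real \<Rightarrow> real" where
  "risk_level N s \<beta> = Inf {\<epsilon> \<in> {0..1}. binomial_tail N s \<epsilon> \<le> \<beta>}"

end

theory Submission imports Defs begin

text \<open>
  For \<open>n = N + m\<close> trajectories and an index set \<open>I\<close> of size \<open>N\<close>, let \<open>v I\<close> be the set of the other
  indices whose trajectories leave the tube calibrated on \<open>T\<^sub>I\<close>.  Given \<open>T\<^sub>I\<close>, the number \<open>card (v I)\<close> is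
  binomial with parameters \<open>m\<close> and \<open>V\<^sub>N\<close>, so for a function \<open>g\<close> on \<open>[0, 1]\<close> the expectation of
  \<open>g (card (v I) / m)\<close> is that of the \<open>m\<close>-th Bernstein polynomial of \<open>g\<close> at \<open>V\<^sub>N\<close>.  On the other hand
  \<open>v I\<close> misses \<open>K \<supseteq> I\<close> iff the boundary of \<open>T\<^sub>K\<close> lies in \<open>I\<close>; if all boundaries have size \<open>s\<close>,
  double counting such pairs shows that for every fixed \<open>T\<close> the sum of \<open>g (card (v I) / m)\<close> over all
  \<open>I\<close> is the value given by the Beta law.  Letting \<open>m\<close> tend to infinity identifies the
  law of \<open>V\<^sub>N\<close>.  For boundaries of size at most \<open>s\<close>, filling them up to size \<open>s\<close> with the lowest indices
  only adds violators, which gives the comparison for monotone \<open>g\<close>.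
\<close>

section \<open>Counting violators\<close>

text \<open>The system is triangular: in the equation for \<open>l = m - d\<close> only the indices
  up to \<open>d\<close> survive, and \<open>d\<close> itself has coefficient 1, so the values are
  recovered one after the other from \<open>d = 0\<close> upwards. It serves to identify a
  distribution on \<open>0..m\<close> by its binomial moments, which count sets of
  nonviolators.\<close>

lemma binomial_moments_determine:
  fixes c c' :: "nat \<Rightarrow> real"
  assumes eq: "\<And>l. l \<le> m \<Longrightarrow>
      (\<Sum>d\<le>m. c d * real ((m - d) choose l)) = (\<Sum>d\<le>m. c' d * real ((m - d) choose l))"
    and "d \<le> m"
  shows "c d = c' d"
  using \<open>d \<le> m\<close>
proof (induction d rule: less_induct)
  case (less d)
  have split: "(\<Sum>i\<le>m. f i * real ((m - i) choose (m - d))) =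
      (\<Sum>i<d. f i * real ((m - i) choose (m - d))) + f d" for f :: "nat \<Rightarrow> real"
  proof -
    have "(\<Sum>i\<le>m. f i * real ((m - i) choose (m - d))) =
        (\<Sum>i\<in>insert d {..<d}. f i * real ((m - i) choose (m - d)))"
      by (rule sum.mono_neutral_right) (use less.prems in \<open>auto simp: binomial_eq_0_iff\<close>)
    then show ?thesis by simp
  qed
  have "(\<Sum>i<d. c i * real ((m - i) choose (m - d))) = (\<Sum>i<d. c' i * real ((m - i) choose (m - d)))"
    using less by (intro sum.cong) auto
  with eq[of "m - d"] split[of c] split[of c'] show ?case by simp
qed

text \<open>With \<open>m\<close> independent trials failing with probability \<open>x\<close>, both
  sides are the expected number of \<open>l\<close>-sets of trials without a failure. Formally, the
  choices of the failures and of the \<open>l\<close>-set are interchanged, and the Bernstein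
  polynomials of degree \<open>m - l\<close> sum to 1.\<close>

lemma sum_Bernstein_binomial:
  assumes "l \<le> m"
  shows "(\<Sum>d\<le>m. Bernstein m d x * real ((m - d) choose l)) = real (m choose l) * (1 - x) ^ l"
proof -
  have *: "Bernstein m d x * real ((m - d) choose l) =
      real (m choose l) * (1 - x) ^ l * Bernstein (m - l) d x" if "d \<le> m - l" for d
  proof -
    have "(m choose d) * ((m - d) choose l) = (m choose l) * ((m - l) choose d)"
    proof -
      have "(m choose d) * ((m - d) choose l) = (m choose (d + l)) * ((d + l) choose d)"
        using choose_mult[of d "d + l" m] that assms by simp
      also have "\<dots> = (m choose (d + l)) * ((d + l) choose l)"
        by (metis add_diff_cancel_left' binomial_symmetric le_add1)
      also have "\<dots> = (m choose l) * ((m - l) choose d)"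
        using choose_mult[of l "d + l" m] that assms by simp
      finally show ?thesis .
    qed
    then have "real (m choose d) * real ((m - d) choose l) = real (m choose l) * real ((m - l) choose d)"
      by (metis of_nat_mult)
    moreover have "(1 - x) ^ (m - d) = (1 - x) ^ l * (1 - x) ^ (m - l - d)"
      using that assms by (simp flip: power_add)
    ultimately show ?thesis unfolding Bernstein_def by (simp add: algebra_simps)
  qed
  have "(\<Sum>d\<le>m. Bernstein m d x * real ((m - d) choose l)) =
      (\<Sum>d\<le>m-l. Bernstein m d x * real ((m - d) choose l))"
    by (rule sum.mono_neutral_right) (auto simp: binomial_eq_0_iff)
  also have "\<dots> = (\<Sum>d\<le>m-l. real (m choose l) * (1 - x) ^ l * Bernstein (m - l) d x)"
    by (intro sum.cong) (auto simp: *)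
  also have "\<dots> = real (m choose l) * (1 - x) ^ l"
    by (simp add: sum_Bernstein flip: sum_distrib_left)
  finally show ?thesis .
qed

lemma card_supersets:
  assumes "finite U" "I \<subseteq> U" "card I \<le> k"
  shows "card {K. I \<subseteq> K \<and> K \<subseteq> U \<and> card K = k} = (card U - card I) choose (k - card I)"
proof -
  have fin: "finite I" "finite (U - I)" using assms finite_subset by auto
  have "bij_betw (\<lambda>L. I \<union> L) {L. L \<subseteq> U - I \<and> card L = k - card I}
      {K. I \<subseteq> K \<and> K \<subseteq> U \<and> card K = k}"
  proof (rule bij_betwI[where g = "\<lambda>K. K - I"])
    show "(\<lambda>L. I \<union> L) \<in> {L. L \<subseteq> U - I \<and> card L = k - card I} \<rightarrow>
        {K. I \<subseteq> K \<and> K \<subseteq> U \<and> card K = k}"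
    proof (clarsimp, intro conjI)
      fix L assume L: "L \<subseteq> U - I" "card L = k - card I"
      then show "L \<subseteq> U" "I \<subseteq> U" using assms by auto
      have "finite L" "I \<inter> L = {}" using L fin finite_subset by auto
      then show "card (I \<union> L) = k" using L assms fin by (simp add: card_Un_disjoint)
    qed
    show "(\<lambda>K. K - I) \<in> {K. I \<subseteq> K \<and> K \<subseteq> U \<and> card K = k} \<rightarrow>
        {L. L \<subseteq> U - I \<and> card L = k - card I}"
      using fin by (auto simp: card_Diff_subset)
  qed auto
  then have "card {K. I \<subseteq> K \<and> K \<subseteq> U \<and> card K = k} = card {L. L \<subseteq> U - I \<and> card L = k - card I}"
    by (simp add: bij_betw_same_card)
  also have "\<dots> = (card U - card I) choose (k - card I)"
    using n_subsets[OF fin(2)] assms fin by (simp add: card_Diff_subset)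
  finally show ?thesis .
qed

text \<open>Double counting of the pairs \<open>I \<subseteq> K\<close> for which no element of \<open>K\<close> violates \<open>I\<close>.\<close>

lemma sum_binomial_violators:
  assumes U: "finite U" "card U = N + m" and "s \<le> N"
    and viol: "\<And>I. viol I \<subseteq> U - I"
    and b: "\<And>K. K \<subseteq> U \<Longrightarrow> N \<le> card K \<Longrightarrow> b K \<subseteq> K \<and> card (b K) = s"
    and equiv: "\<And>I K. I \<subseteq> K \<Longrightarrow> K \<subseteq> U \<Longrightarrow> card I = N \<Longrightarrow> viol I \<inter> K = {} \<longleftrightarrow> b K \<subseteq> I"
    and "l \<le> m"
  shows "(\<Sum>I | I \<subseteq> U \<and> card I = N. (m - card (viol I)) choose l) =
    ((N + m) choose (N + l)) * ((N + l - s) choose l)"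
proof -
  let ?I = "{I. I \<subseteq> U \<and> card I = N}" and ?K = "{K. K \<subseteq> U \<and> card K = N + l}"
  have fin: "finite ?I" "finite ?K" using U by (auto intro: finite_subset[OF _ finite_Pow_iff[THEN iffD2]])
  have "(\<Sum>I\<in>?I. (m - card (viol I)) choose l) =
      (\<Sum>I\<in>?I. card {K\<in>?K. I \<subseteq> K \<and> viol I \<inter> K = {}})"
  proof (rule sum.cong[OF refl])
    fix I assume I: "I \<in> ?I"
    have "{K\<in>?K. I \<subseteq> K \<and> viol I \<inter> K = {}} = {K. I \<subseteq> K \<and> K \<subseteq> U - viol I \<and> card K = N + l}"
      by auto
    moreover have "card (U - viol I) = N + m - card (viol I)"
      using U viol[of I] by (metis Diff_subset card_Diff_subset finite_subset order_trans)
    moreover have "I \<subseteq> U - viol I" using viol[of I] I by auto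
    ultimately show "(m - card (viol I)) choose l = card {K\<in>?K. I \<subseteq> K \<and> viol I \<inter> K = {}}"
      using card_supersets[of "U - viol I" I "N + l"] U I by simp
  qed
  also have "\<dots> = (\<Sum>K\<in>?K. card {I\<in>?I. I \<subseteq> K \<and> viol I \<inter> K = {}})"
    using sum_multicount_gen[OF fin, of "\<lambda>I K. I \<subseteq> K \<and> viol I \<inter> K = {}"
      "\<lambda>K. card {I\<in>?I. I \<subseteq> K \<and> viol I \<inter> K = {}}"] by simp
  \<comment> \<open>For fixed \<open>K\<close> the sets \<open>I\<close> are those between
    \<open>b K\<close> and \<open>K\<close>; their number depends only on the sizes, not on which
    set \<open>b K\<close> is.\<close>
  also have "\<dots> = (\<Sum>K\<in>?K. (N + l - s) choose (N - s))"
  proof (rule sum.cong[OF refl])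
    fix K assume K: "K \<in> ?K"
    have "{I\<in>?I. I \<subseteq> K \<and> viol I \<inter> K = {}} = {I. b K \<subseteq> I \<and> I \<subseteq> K \<and> card I = N}"
      using equiv K by blast
    then show "card {I\<in>?I. I \<subseteq> K \<and> viol I \<inter> K = {}} = (N + l - s) choose (N - s)"
      using card_supersets[of K "b K" N] K b[of K] \<open>s \<le> N\<close> finite_subset[OF _ U(1)] by simp
  qed
  also have "\<dots> = ((N + m) choose (N + l)) * ((N + l - s) choose (N - s))"
    using n_subsets[OF U(1)] U by simp
  also have "(N + l - s) choose (N - s) = (N + l - s) choose l"
    using binomial_symmetric[of l "N + l - s"] \<open>s \<le> N\<close> by simp
  finally show ?thesis .
qed

section \<open>Filling boundaries up to a fixed size\<close>

definition lowest :: "nat \<Rightarrow> 'i::linorder set \<Rightarrow> 'i set" where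
  "lowest r A = {j \<in> A. card {i \<in> A. i < j} < r}"

text \<open>The rank \<open>?rk\<close> is strictly increasing on \<open>A\<close>, hence a
  bijection onto \<open>{..<card A}\<close>, and \<open>lowest r A\<close> is the preimage of the
  first \<open>r\<close> ranks.\<close>

lemma card_lowest:
  assumes "finite A" "r \<le> card A"
  shows "card (lowest r A) = r"
proof -
  let ?rk = "\<lambda>j. card {i \<in> A. i < j}"
  have mono: "?rk j < ?rk k" if "j \<in> A" "j < k" for j k
  proof (rule psubset_card_mono)
    show "{i \<in> A. i < j} \<subset> {i \<in> A. i < k}"
      using that by (intro psubsetI) (auto dest: less_trans)
  qed (use assms in simp)
  have inj: "inj_on ?rk A"
  proof (rule linorder_inj_onI')
    fix j k assume "j \<in> A" "j < k"
    then show "?rk j \<noteq> ?rk k" using mono[of j k] by simp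
  qed
  have "?rk j < card A" if "j \<in> A" for j
    using that assms by (intro psubset_card_mono psubsetI) auto
  then have "?rk ` A \<subseteq> {..<card A}" by auto
  then have im: "?rk ` A = {..<card A}"
    using inj by (intro card_subset_eq) (auto simp: card_image)
  have "?rk ` lowest r A = {..<r}"
  proof -
    have "?rk ` lowest r A = {k \<in> ?rk ` A. k < r}" by (auto simp: lowest_def)
    then show ?thesis using im assms by auto
  qed
  moreover have "inj_on ?rk (lowest r A)" using inj by (rule inj_on_subset) (auto simp: lowest_def)
  then have "card (lowest r A) = card (?rk ` lowest r A)" by (rule card_image[symmetric])
  ultimately show ?thesis by simp
qed

text \<open>
  A boundary of size less than \<open>s\<close> is filled up by the lowest remaining indices; this only enlarges
  the set of violators.
\<close>

lemma enlarge_boundary: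
  fixes U :: "'i::linorder set"
  assumes U: "finite U"
    and viol: "\<And>I. viol I \<subseteq> U - I"
    and b: "\<And>K. K \<subseteq> U \<Longrightarrow> s \<le> card K \<Longrightarrow> b K \<subseteq> K \<and> card (b K) \<le> s"
    and equiv: "\<And>I K. I \<subseteq> K \<Longrightarrow> K \<subseteq> U \<Longrightarrow> s \<le> card I \<Longrightarrow> viol I \<inter> K = {} \<longleftrightarrow> b K \<subseteq> I"
    and proj: "\<And>I K. I \<subseteq> K \<Longrightarrow> K \<subseteq> U \<Longrightarrow> s \<le> card I \<Longrightarrow> b K \<subseteq> I \<Longrightarrow> b I = b K"
  obtains viol' b' where "\<And>I. viol I \<subseteq> viol' I" "\<And>I. viol' I \<subseteq> U - I"
    "\<And>K. K \<subseteq> U \<Longrightarrow> s \<le> card K \<Longrightarrow> b' K \<subseteq> K \<and> card (b' K) = s"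
    "\<And>I K. I \<subseteq> K \<Longrightarrow> K \<subseteq> U \<Longrightarrow> s \<le> card I \<Longrightarrow> viol' I \<inter> K = {} \<longleftrightarrow> b' K \<subseteq> I"
proof
  \<comment> \<open>An index \<open>j\<close> outside \<open>I\<close> is added precisely when it
    would enter the filled-up boundary of \<open>insert j I\<close>, supposing that the original
    boundary is still \<open>b I\<close>.\<close>
  define viol' where
    "viol' I = viol I \<union> {j \<in> U - I. card {i \<in> I - b I. i < j} < s - card (b I)}" for I
  define b' where "b' K = b K \<union> lowest (s - card (b K)) (K - b K)" for K
  show "viol I \<subseteq> viol' I" "viol' I \<subseteq> U - I" for I
    using viol by (auto simp: viol'_def)
  have card_rest: "s - card (b K) \<le> card (K - b K)" if "K \<subseteq> U" "s \<le> card K" for K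
    using b[OF that] that U by (metis card_Diff_subset diff_le_mono finite_subset)
  have fin: "finite K" if "K \<subseteq> U" for K using that U finite_subset by blast
  show "b' K \<subseteq> K \<and> card (b' K) = s" if K: "K \<subseteq> U" "s \<le> card K" for K
  proof -
    have "card (b' K) = card (b K) + card (lowest (s - card (b K)) (K - b K))"
      unfolding b'_def using fin[OF K(1)] b[OF K]
      by (intro card_Un_disjoint) (auto simp: lowest_def intro: finite_subset)
    then show ?thesis
      using card_lowest[OF _ card_rest[OF K]] fin[OF K(1)] b[OF K] by (auto simp: b'_def lowest_def)
  qed
  show "viol' I \<inter> K = {} \<longleftrightarrow> b' K \<subseteq> I" if I: "I \<subseteq> K" and K: "K \<subseteq> U" and s: "s \<le> card I" for I K
  proof (cases "b K \<subseteq> I")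
    case False
    then show ?thesis using equiv[OF I K s] by (auto simp: viol'_def b'_def)
  next
    case True
    \<comment> \<open>By projectivity \<open>I\<close> and \<open>K\<close> share their boundary,
      hence also the number \<open>r\<close> of indices that have to be filled in.\<close>
    then have bI: "b I = b K" using proj I K s by blast
    have sK: "s \<le> card K" using s I fin[OF K] card_mono le_trans by blast
    define r where "r = s - card (b K)"
    define S where "S = lowest r (K - b K)"
    have cS: "card S = r"
      unfolding S_def r_def using fin[OF K] card_rest[OF K sK] by (intro card_lowest) auto
    \<comment> \<open>If \<open>S\<close> lies in \<open>I\<close>, each \<open>j\<close> in
      \<open>K - I\<close> has rank at least \<open>r\<close>, so it lies above all of
      \<open>S\<close> and has \<open>r\<close> predecessors inside \<open>I\<close>. Conversely,
      \<open>r\<close> predecessors in \<open>I\<close> give at least that many in \<open>K\<close>,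
      which keeps \<open>j\<close> out of \<open>S\<close>.\<close>
    have "(\<forall>j\<in>K - I. r \<le> card {i \<in> I - b K. i < j}) \<longleftrightarrow> S \<subseteq> I"
    proof
      assume *: "\<forall>j\<in>K - I. r \<le> card {i \<in> I - b K. i < j}"
      have "j \<notin> S" if "j \<in> K - I" for j
      proof -
        have "card {i \<in> I - b K. i < j} \<le> card {i \<in> K - b K. i < j}"
          using I fin[OF K] by (intro card_mono) auto
        then show ?thesis using * that by (force simp: S_def lowest_def)
      qed
      then show "S \<subseteq> I" by (auto simp: S_def lowest_def)
    next
      assume SI: "S \<subseteq> I"
      show "\<forall>j\<in>K - I. r \<le> card {i \<in> I - b K. i < j}"
      proof
        fix j assume j: "j \<in> K - I"
        then have rj: "r \<le> card {i \<in> K - b K. i < j}"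
          using SI True by (force simp: S_def lowest_def)
        have "i < j" if "i \<in> S" for i
        proof (rule ccontr)
          assume "\<not> i < j"
          then have "card {k \<in> K - b K. k < j} \<le> card {k \<in> K - b K. k < i}"
            using fin[OF K] by (intro card_mono) auto
          then show False using rj that by (auto simp: S_def lowest_def)
        qed
        then have "S \<subseteq> {i \<in> I - b K. i < j}" using SI by (auto simp: S_def lowest_def)
        then have "card S \<le> card {i \<in> I - b K. i < j}"
          using fin[of I] I K by (intro card_mono) auto
        then show "r \<le> card {i \<in> I - b K. i < j}" using cS by simp
      qed
    qed
    moreover have "viol' I \<inter> K = {} \<longleftrightarrow> (\<forall>j\<in>K - I. r \<le> card {i \<in> I - b K. i < j})"
      unfolding viol'_def bI r_def[symmetric] not_less[symmetric] using equiv[OF I K s] True K by auto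
    ultimately show ?thesis using True by (auto simp: b'_def S_def r_def)
  qed
qed

section \<open>The Beta law\<close>

abbreviation beta_measure :: "nat \<Rightarrow> nat \<Rightarrow> real measure" where
  "beta_measure N s \<equiv> density lborel (\<lambda>x. ennreal (beta_density (real s) (real N - real s + 1) x))"

text \<open>Differentiating the sum term by term telescopes: by absorption,
  \<open>(N - s) * (N choose s) = (s + 1) * (N choose (s + 1))\<close>, so the negative part of each
  term cancels the positive part of the next one. For positive \<open>s\<close>, what is left is on
  the open unit interval minus the Beta density with parameters \<open>s\<close> and
  \<open>N - s + 1\<close>.\<close>

lemma binomial_tail_has_derivative:
  assumes "s \<le> N"
  shows "(binomial_tail N s has_real_derivative
    - (real s * real (N choose s) * x ^ (s - 1) * (1 - x) ^ (N - s))) (at x)"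
  using assms
proof (induction s)
  case 0
  then show ?case by (simp add: binomial_tail_def)
next
  case (Suc s)
  have eq: "binomial_tail N (Suc s) =
      (\<lambda>x. binomial_tail N s x + real (N choose s) * x ^ s * (1 - x) ^ (N - s))"
    by (simp add: binomial_tail_def fun_eq_iff)
  have "real (Suc s) * real (N choose Suc s) = real (N - s) * real (N choose s)"
   (is "?l = ?r")
    using Suc_times_binomial_eq[of N s] binomial_absorb_comp[of N s] binomial_absorption[of s N]
    by (metis of_nat_mult)
  then have absorb: "real (N choose s) * (real (N - s) * t) = real (Suc s) * real (N choose Suc s) * t" for t
    by (simp only: mult.assoc mult.left_commute)
  have "((\<lambda>x. real (N choose s) * x ^ s * (1 - x) ^ (N - s)) has_real_derivative
      real (N choose s) * (real s * x ^ (s - 1)) * (1 - x) ^ (N - s) -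
      real (N choose s) * (real (N - s) * (x ^ s * (1 - x) ^ (N - Suc s)))) (at x)"
    by (rule derivative_eq_intros refl | simp)+
  from DERIV_add[OF Suc.IH this[unfolded absorb]] Suc.prems show ?case
    unfolding eq by (simp add: mult_ac)
qed

text \<open>For these integer parameters the Beta function is \<open>(s - 1)! (N - s)! / N!\<close>,
  the reciprocal of \<open>s * (N choose s)\<close>.\<close>

lemma beta_density_binomial:
  assumes "1 \<le> s" "s \<le> N" "0 < x" "x < 1"
  shows "beta_density (real s) (real N - real s + 1) x =
    real s * real (N choose s) * x ^ (s - 1) * (1 - x) ^ (N - s)"
proof -
  obtain k where k: "s = Suc k" using assms by (cases s) auto
  have "Beta (real s) (real N - real s + 1) = fact k * fact (N - s) / fact N"
    using Gamma_fact[of k, where 'a = real] Gamma_fact[of "N - s", where 'a = real]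
      Gamma_fact[of N, where 'a = real] assms
    by (simp add: Beta_def k of_nat_diff algebra_simps)
  moreover have "real s * real (N choose s) = fact N / (fact k * fact (N - s))"
    using assms by (simp add: binomial_fact k del: of_nat_Suc)
  moreover have "x powr (real s - 1) = x ^ (s - 1)" "(1 - x) powr (real N - real s + 1 - 1) = (1 - x) ^ (N - s)"
    using assms k powr_realpow[of "1 - x" "N - s"]
    by (simp_all add: powr_realpow algebra_simps)
  ultimately show ?thesis using assms by (simp add: beta_density_def)
qed

lemma beta_density_nonneg: "1 \<le> s \<Longrightarrow> s \<le> N \<Longrightarrow> 0 \<le> beta_density (real s) (real N - real s + 1) x"
  using beta_density_binomial[of s N x] by (cases "0 < x \<and> x < 1") (auto simp: beta_density_def)

lemma borel_measurable_beta_density [measurable]: "beta_density a b \<in> borel_measurable borel"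
  unfolding beta_density_def[abs_def] by measurable

text \<open>The binomial tail is minus a primitive of the density and vanishes at 1. The set
  \<open>A\<close> is only fixed inside the open unit interval and off \<open>\<epsilon>\<close>, so
  that the lemma covers both a half-line and, with \<open>\<epsilon> = 0\<close>, the whole
  space.\<close>

lemma emeasure_beta_greaterThan:
  assumes "1 \<le> s" "s \<le> N" "0 \<le> \<epsilon>" "\<epsilon> \<le> 1" "A \<in> sets borel" "A \<inter> {0<..<1} - {\<epsilon>} = {\<epsilon><..<1}"
  shows "emeasure (beta_measure N s) A = ennreal (binomial_tail N s \<epsilon>)"
proof -
  let ?f = "\<lambda>x. real s * real (N choose s) * x ^ (s - 1) * (1 - x) ^ (N - s)"
  have "emeasure (beta_measure N s) A =
      (\<integral>\<^sup>+x. ennreal (beta_density (real s) (real N - real s + 1) x) * indicator A x \<partial>lborel)"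
    using assms(5) by (simp add: emeasure_density)
  also have "\<dots> = (\<integral>\<^sup>+x. ennreal (?f x) * indicator {\<epsilon>..1} x \<partial>lborel)"
  proof (rule nn_integral_cong_AE)
    \<comment> \<open>Two points are left out: \<open>A\<close> may or may not contain
      \<open>\<epsilon>\<close>, and at 1 the density is 0 while the polynomial \<open>?f\<close> is
      not when \<open>s = N\<close>.\<close>
    show "AE x in lborel. ennreal (beta_density (real s) (real N - real s + 1) x) * indicator A x =
        ennreal (?f x) * indicator {\<epsilon>..1} x"
      using AE_lborel_singleton[of \<epsilon>] AE_lborel_singleton[of 1]
    proof eventually_elim
      case (elim x)
      show ?case
      proof (cases "0 < x \<and> x < 1")
        case True
        then have "x \<in> A \<longleftrightarrow> x \<in> {\<epsilon>..1}"
          using elim assms(6)[THEN eqset_imp_iff, of x] by auto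
        then show ?thesis
          using True beta_density_binomial[OF assms(1,2), of x] by (simp add: indicator_def)
      next
        case False
        then show ?thesis using elim assms(3) by (auto simp: beta_density_def indicator_def)
      qed
    qed
  qed
  also have "\<dots> = ennreal (- binomial_tail N s 1 - (- binomial_tail N s \<epsilon>))"
  proof (rule nn_integral_FTC_Icc)
    show "((\<lambda>x. - binomial_tail N s x) has_real_derivative ?f x) (at x)" for x
      using DERIV_minus[OF binomial_tail_has_derivative[OF assms(2), of x]] by simp
    show "0 \<le> ?f x" if "x \<in> {\<epsilon>..1}" for x
      using that assms(3) by (intro mult_nonneg_nonneg zero_le_power) auto
  qed (use assms(4) in \<open>simp_all\<close>)
  also have "binomial_tail N s 1 = 0"
    unfolding binomial_tail_def using assms by (intro sum.neutral) auto
  finally show ?thesis by simp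
qed

lemma binomial_tail_0: "1 \<le> s \<Longrightarrow> binomial_tail N s 0 = 1"
proof -
  assume "1 \<le> s"
  have "binomial_tail N s 0 = (\<Sum>j<s. if j = 0 then 1 else 0)"
    unfolding binomial_tail_def by (intro sum.cong) auto
  then show ?thesis using \<open>1 \<le> s\<close> by simp
qed

lemma prob_space_beta:
  assumes "1 \<le> s" "s \<le> N"
  shows "prob_space (beta_measure N s)"
proof (rule prob_spaceI)
  have "UNIV \<inter> {0<..<1} - {0} = {0<..<1::real}" by auto
  from emeasure_beta_greaterThan[OF assms _ _ _ this]
  show "emeasure (beta_measure N s) (space (beta_measure N s)) = 1"
    using assms by (simp add: binomial_tail_0)
qed

lemma AE_beta_unit: "AE x in beta_measure N s. x \<in> {0..1}"
  by (subst AE_density) (auto simp: beta_density_def intro!: AE_I2)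

text \<open>The factor \<open>(1 - x) ^ l\<close> turns the density with parameters \<open>s\<close>
  and \<open>N - s + 1\<close> into a multiple of the one with \<open>N + l\<close> in place of
  \<open>N\<close>; the moment is the ratio of the normalizing constants.\<close>

lemma beta_moment:
  assumes "1 \<le> s" "s \<le> N"
  shows "(\<integral>x. (1 - x) ^ l \<partial>beta_measure N s) = real (N choose s) / real ((N + l) choose s)"
proof -
  let ?d = "\<lambda>N. beta_density (real s) (real N - real s + 1)"
  let ?c = "real (N choose s) / real ((N + l) choose s)"
  have "(\<integral>x. (1 - x) ^ l \<partial>beta_measure N s) = (\<integral>x. ?d N x * (1 - x) ^ l \<partial>lborel)"
    using assms by (subst integral_density) (auto intro!: AE_I2 beta_density_nonneg)
  also have "\<dots> = (\<integral>x. ?c * ?d (N + l) x \<partial>lborel)"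
  proof (rule Bochner_Integration.integral_cong[OF refl])
    fix x :: real
    have "0 < (N + l) choose s" using assms by simp
    moreover have "(1 - x) ^ (N + l - s) = (1 - x) ^ l * (1 - x) ^ (N - s)"
      using assms by (simp add: add.commute flip: power_add)
    ultimately show "?d N x * (1 - x) ^ l = ?c * ?d (N + l) x"
      using beta_density_binomial[of s N x] beta_density_binomial[of s "N + l" x] assms
      by (cases "0 < x \<and> x < 1") (auto simp: beta_density_def power_add field_simps)
  qed
  also have "\<dots> = ?c * (\<integral>x. ?d (N + l) x \<partial>lborel)" by simp
  also have "(\<integral>x. ?d (N + l) x \<partial>lborel) = (\<integral>x. 1 \<partial>beta_measure (N + l) s)"
    using assms beta_density_nonneg[of s "N + l"]
    by (subst integral_density) (auto intro!: AE_I2)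
  also have "\<dots> = 1"
    using prob_space.prob_space[OF prob_space_beta[of s "N + l"]] assms by simp
  finally show ?thesis by simp
qed

section \<open>Violator counts averaged over all index sets of size \<open>N\<close>\<close>

lemma integrable_continuous_unit:
  fixes f :: "real \<Rightarrow> real"
  assumes "prob_space D" "sets D = sets borel" "AE x in D. x \<in> {0..1}" "continuous_on UNIV f"
  shows "integrable D f"
proof -
  interpret prob_space D by fact
  have "continuous_on {0..1} f" using assms(4) continuous_on_subset by blast
  then have "bounded (f ` {0..1})" by (intro compact_imp_bounded compact_continuous_image) auto
  then obtain K where K: "\<And>x. x \<in> {0..1} \<Longrightarrow> norm (f x) \<le> K" unfolding bounded_iff by blast
  show ?thesis
  proof (rule integrable_const_bound)
    show "AE x in D. norm (f x) \<le> K" using assms(3) by eventually_elim (rule K)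
    show "f \<in> borel_measurable D"
      using borel_measurable_continuous_onI[OF assms(4)] assms(2) measurable_cong_sets by blast
  qed
qed

lemma continuous_on_Bernstein: "continuous_on A (Bernstein m d)"
  unfolding Bernstein_def[abs_def] by (intro continuous_intros)

text \<open>Here the double count of \<open>sum_binomial_violators\<close> meets
  \<open>beta_moment\<close>: after expansion into factorials both sides are the same
  quotient.\<close>

lemma choose_mult_beta_moment:
  assumes "s \<le> N" "l \<le> m"
  shows "real ((N + m) choose (N + l)) * real ((N + l - s) choose l) =
    real ((N + m) choose N) * (real (m choose l) * (real (N choose s) / real ((N + l) choose s)))"
proof -
  have eqs: "real ((N + m) choose (N + l)) = fact (N + m) / (fact (N + l) * fact (m - l))"
    "real ((N + l - s) choose l) = fact (N + l - s) / (fact l * fact (N - s))"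
    "real ((N + m) choose N) = fact (N + m) / (fact N * fact m)"
    "real (m choose l) = fact m / (fact l * fact (m - l))"
    "real (N choose s) = fact N / (fact s * fact (N - s))"
    "real ((N + l) choose s) = fact (N + l) / (fact s * fact (N + l - s))"
    using assms by (simp_all add: binomial_fact)
  show ?thesis unfolding eqs by simp
qed

text \<open>For one fixed configuration, \<open>c d\<close> counts the sets \<open>I\<close> with
  \<open>d\<close> violators, and \<open>c' d\<close> is the number predicted by a binomial law with
  Beta-distributed parameter. Their binomial moments agree, on one side by double counting and on
  the other by \<open>sum_Bernstein_binomial\<close> and \<open>beta_moment\<close>, so they
  coincide and any \<open>g\<close> may be summed against them.\<close>

lemma sum_violators_beta:
  assumes s: "1 \<le> s" "s \<le> N" and U: "finite U" "card U = N + m"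
    and viol: "\<And>I. viol I \<subseteq> U - I"
    and b: "\<And>K. K \<subseteq> U \<Longrightarrow> N \<le> card K \<Longrightarrow> b K \<subseteq> K \<and> card (b K) = s"
    and equiv: "\<And>I K. I \<subseteq> K \<Longrightarrow> K \<subseteq> U \<Longrightarrow> card I = N \<Longrightarrow> viol I \<inter> K = {} \<longleftrightarrow> b K \<subseteq> I"
  shows "(\<Sum>I | I \<subseteq> U \<and> card I = N. g (card (viol I))) =
    real ((N + m) choose N) * (\<integral>x. (\<Sum>d\<le>m. g d * Bernstein m d x) \<partial>beta_measure N s)"
proof -
  let ?F = "{I. I \<subseteq> U \<and> card I = N}"
  let ?D = "beta_measure N s"
  define c where "c d = real (card {I \<in> ?F. card (viol I) = d})" for d
  define c' where "c' d = real ((N + m) choose N) * (\<integral>x. Bernstein m d x \<partial>?D)" for d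
  have finF: "finite ?F" using U by simp
  have card_viol: "card (viol I) \<le> m" if "I \<in> ?F" for I
  proof -
    have "card (viol I) \<le> card (U - I)" using viol U by (intro card_mono) auto
    moreover have "finite I" using that U finite_subset by blast
    ultimately show ?thesis using that U by (simp add: card_Diff_subset)
  qed
  have group: "(\<Sum>I\<in>?F. h (card (viol I))) = (\<Sum>d\<le>m. c d * h d)" for h :: "nat \<Rightarrow> real"
  proof -
    have "(\<Sum>I\<in>?F. h (card (viol I))) =
        (\<Sum>d\<le>m. \<Sum>I | I \<in> ?F \<and> card (viol I) = d. h (card (viol I)))"
      using finF card_viol by (intro sum.group[symmetric]) auto
    also have "\<dots> = (\<Sum>d\<le>m. c d * h d)"
      by (intro sum.cong) (auto simp: c_def)
    finally show ?thesis .
  qed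
  have int: "integrable ?D (\<lambda>x. Bernstein m d x)" for d
    by (intro integrable_continuous_unit prob_space_beta s AE_beta_unit continuous_on_Bernstein) simp
  have lin: "(\<Sum>d\<le>m. c' d * h d) =
      real ((N + m) choose N) * (\<integral>x. (\<Sum>d\<le>m. h d * Bernstein m d x) \<partial>?D)" for h
    by (simp add: c'_def int sum_distrib_left mult_ac)
  have "c d = c' d" if "d \<le> m" for d
  proof (rule binomial_moments_determine[OF _ that])
    fix l assume l: "l \<le> m"
    have "(\<Sum>d\<le>m. c d * real ((m - d) choose l)) =
        real (\<Sum>I\<in>?F. (m - card (viol I)) choose l)"
      using group[of "\<lambda>d. real ((m - d) choose l)"] by simp
    also have "\<dots> = real ((N + m) choose (N + l)) * real ((N + l - s) choose l)"
      by (subst sum_binomial_violators[OF U s(2) viol b equiv l]) (simp_all only: of_nat_mult)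
    also have "\<dots> = real ((N + m) choose N) * (real (m choose l) * (\<integral>x. (1 - x) ^ l \<partial>?D))"
      unfolding beta_moment[OF s] by (rule choose_mult_beta_moment[OF s(2) l])
    also have "\<dots> = real ((N + m) choose N) *
        (\<integral>x. (\<Sum>d\<le>m. real ((m - d) choose l) * Bernstein m d x) \<partial>?D)"
      using sum_Bernstein_binomial[OF l] by (simp add: mult.commute)
    finally show "(\<Sum>d\<le>m. c d * real ((m - d) choose l)) = (\<Sum>d\<le>m. c' d * real ((m - d) choose l))"
      using lin by simp
  qed
  then show ?thesis using group[of g] lin[of g] by simp
qed

section \<open>Risk of a tube calibrated on an i.i.d. sample\<close>

text \<open>Tube family and calibrator act only together, through the set \<open>G T\<close>
  calibrated on the list \<open>T\<close>; joint measurability of membership makes the risk a random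
  variable.\<close>

locale list_tube = prob_space P for P :: "'a measure" +
  fixes G :: "'a list \<Rightarrow> 'a set"
  assumes tube_sets: "\<And>n. {p \<in> space ((\<Pi>\<^sub>M i\<in>{..<n}. P) \<Otimes>\<^sub>M P). snd p \<in> G (map (fst p) [0..<n])}
      \<in> sets ((\<Pi>\<^sub>M i\<in>{..<n}. P) \<Otimes>\<^sub>M P)"
begin

abbreviation PP :: "nat \<Rightarrow> (nat \<Rightarrow> 'a) measure" where
  "PP n \<equiv> \<Pi>\<^sub>M i\<in>{..<n}. P"

definition risk :: "nat \<Rightarrow> (nat \<Rightarrow> 'a) \<Rightarrow> real" where
  "risk n f = prob {x \<in> space P. x \<notin> G (map f [0..<n])}"

lemma prob_space_PP: "prob_space (PP n)"
  by (intro prob_space_PiM prob_space_axioms)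

lemma measurable_reindex [measurable]:
  "set xs \<subseteq> {..<n} \<Longrightarrow> (\<lambda>f. \<lambda>i\<in>{..<length xs}. f (xs ! i)) \<in> PP n \<rightarrow>\<^sub>M PP (length xs)"
  by (intro measurable_restrict measurable_component_singleton) (auto dest: nth_mem)

lemma map_reindex: "map (\<lambda>i\<in>{..<length xs}. f (xs ! i)) [0..<length xs] = map f xs"
  by (rule nth_equalityI) auto

text \<open>Distinct coordinates of an i.i.d. tuple, in any order, are again i.i.d.; this allows any
  index set to act as the calibration sample.\<close>

lemma distr_reindex:
  assumes "distinct xs" "set xs \<subseteq> {..<n}"
  shows "distr (PP n) (PP (length xs)) (\<lambda>f. \<lambda>i\<in>{..<length xs}. f (xs ! i)) = PP (length xs)"
  using distr_PiM_reindex[of "{..<n}" "\<lambda>_. P" "(!) xs" "{..<length xs}"] assms prob_space_axioms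
  by (auto simp: inj_on_def nth_eq_iff_index_eq dest: nth_mem)

lemma AE_reindex:
  assumes "distinct xs" "set xs \<subseteq> {..<n}" "AE g in PP (length xs). Q (map g [0..<length xs])"
  shows "AE f in PP n. Q (map f xs)"
proof -
  have "AE g in distr (PP n) (PP (length xs)) (\<lambda>f. \<lambda>i\<in>{..<length xs}. f (xs ! i)).
      Q (map g [0..<length xs])"
    unfolding distr_reindex[OF assms(1,2)] by (rule assms(3))
  from AE_distrD[OF measurable_reindex[OF assms(2)] this] show ?thesis
    by (simp only: map_reindex)
qed

lemma measurable_mem [measurable]:
  assumes "set xs \<subseteq> {..<n}" "j < n"
  shows "Measurable.pred (PP n) (\<lambda>f. f j \<in> G (map f xs))"
proof -
  have "(\<lambda>f. (\<lambda>i\<in>{..<length xs}. f (xs ! i), f j)) \<in> PP n \<rightarrow>\<^sub>M PP (length xs) \<Otimes>\<^sub>M P"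
    using assms measurable_reindex[OF assms(1)] by (intro measurable_Pair) auto
  moreover have "Measurable.pred (PP (length xs) \<Otimes>\<^sub>M P) (\<lambda>p. snd p \<in> G (map (fst p) [0..<length xs]))"
    unfolding pred_def by (rule tube_sets)
  ultimately have "Measurable.pred (PP n) (\<lambda>f. (\<lambda>p. snd p \<in> G (map (fst p) [0..<length xs]))
      (\<lambda>i\<in>{..<length xs}. f (xs ! i), f j))"
    by (rule measurable_compose)
  then show ?thesis by (simp only: map_reindex fst_conv snd_conv)
qed

lemma tube_section:
  assumes "f \<in> space (PP n)"
  shows "{x \<in> space P. x \<in> G (map f [0..<n])} \<in> events"
proof -
  have "Measurable.pred (PP n \<Otimes>\<^sub>M P) (\<lambda>p. snd p \<in> G (map (fst p) [0..<n]))"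
    unfolding pred_def by (rule tube_sets)
  from measurable_compose[OF measurable_Pair1'[OF assms] this] show ?thesis
    by (simp add: pred_def)
qed

lemma risk_eq: "f \<in> space (PP n) \<Longrightarrow> risk n f = 1 - prob {x \<in> space P. x \<in> G (map f [0..<n])}"
  using prob_neg[of "\<lambda>x. x \<in> G (map f [0..<n])"] tube_section by (simp add: risk_def)

lemma risk_bounds: "0 \<le> risk n f" "risk n f \<le> 1"
  by (auto simp: risk_def)

lemma measurable_risk [measurable]: "risk n \<in> borel_measurable (PP n)"
proof -
  have "(\<lambda>f. emeasure P (Pair f -` {p \<in> space (PP n \<Otimes>\<^sub>M P). snd p \<in> G (map (fst p) [0..<n])}))
      \<in> borel_measurable (PP n)"
    by (rule measurable_emeasure_Pair[OF tube_sets])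
  then have "(\<lambda>f. 1 - enn2real (emeasure P (Pair f -` {p \<in> space (PP n \<Otimes>\<^sub>M P). snd p \<in> G (map (fst p) [0..<n])})))
      \<in> borel_measurable (PP n)"
    by measurable
  then show ?thesis
    by (rule measurable_cong[THEN iffD1, rotated])
      (auto simp: risk_eq measure_def space_pair_measure intro!: arg_cong[where f = enn2real] arg_cong[where f = "emeasure P"])
qed

text \<open>By Fubini the first \<open>N\<close> coordinates may be fixed; the tube is then a fixed
  set, and each of the \<open>l\<close> independent remaining coordinates lies in it with
  probability \<open>1 - risk N f\<close>.\<close>

lemma prob_fresh_satisfied:
  "measure (PP (N + l)) {f \<in> space (PP (N + l)). \<forall>j\<in>{N..<N+l}. f j \<in> G (map f [0..<N])} =
    (\<integral>f. (1 - risk N f) ^ l \<partial>PP N)"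
proof -
  interpret Q: product_prob_space "\<lambda>_::nat. P" UNIV
    by unfold_locales
  let ?S = "{f \<in> space (PP (N + l)). \<forall>j\<in>{N..<N+l}. f j \<in> G (map f [0..<N])}"
  let ?J = "{N..<N+l}"
  have un: "{..<N} \<union> ?J = {..<N + l}" by auto
  have S: "?S \<in> sets (PP (N + l))" by measurable auto
  have "emeasure (PP (N + l)) ?S = (\<integral>\<^sup>+f. indicator ?S f \<partial>PiM ({..<N} \<union> ?J) (\<lambda>_. P))"
    using S by (simp add: un)
  also have "\<dots> = (\<integral>\<^sup>+x. \<integral>\<^sup>+y. indicator ?S (merge {..<N} ?J (x, y)) \<partial>PiM ?J (\<lambda>_. P) \<partial>PP N)"
    using S by (intro Q.product_nn_integral_fold) (auto simp: un)
  also have "\<dots> = (\<integral>\<^sup>+x. ennreal ((1 - risk N x) ^ l) \<partial>PP N)"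
  proof (rule nn_integral_cong)
    fix x assume x: "x \<in> space (PP N)"
    let ?g = "{z \<in> space P. z \<in> G (map x [0..<N])}"
    have "(\<integral>\<^sup>+y. indicator ?S (merge {..<N} ?J (x, y)) \<partial>PiM ?J (\<lambda>_. P)) =
        (\<integral>\<^sup>+y. indicator (PiE ?J (\<lambda>_. ?g)) y \<partial>PiM ?J (\<lambda>_. P))"
    proof (rule nn_integral_cong)
      fix y assume y: "y \<in> space (PiM ?J (\<lambda>_. P))"
      have sp: "merge {..<N} ?J (x, y) \<in> space (PP (N + l))"
        using x y by (auto simp: space_PiM merge_def PiE_def extensional_def Pi_def)
      have m: "map (merge {..<N} ?J (x, y)) [0..<N] = map x [0..<N]" by (simp add: merge_def)
      have "merge {..<N} ?J (x, y) \<in> ?S \<longleftrightarrow> (\<forall>j\<in>?J. merge {..<N} ?J (x, y) j \<in> G (map x [0..<N]))"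
        by (simp only: mem_Collect_eq m sp simp_thms)
      also have "\<dots> \<longleftrightarrow> (\<forall>j\<in>?J. y j \<in> G (map x [0..<N]))"
        by (intro ball_cong refl) (simp add: merge_def)
      also have "\<dots> \<longleftrightarrow> y \<in> PiE ?J (\<lambda>_. ?g)"
        using y by (auto simp: space_PiM PiE_def Pi_def)
      finally have "merge {..<N} ?J (x, y) \<in> ?S \<longleftrightarrow> y \<in> PiE ?J (\<lambda>_. ?g)" .
      then show "indicator ?S (merge {..<N} ?J (x, y)) = (indicator (PiE ?J (\<lambda>_. ?g)) y :: ennreal)"
        by (simp only: indicator_def)
    qed
    also have "\<dots> = emeasure (PiM ?J (\<lambda>_. P)) (PiE ?J (\<lambda>_. ?g))"
      using tube_section[OF x] by (intro nn_integral_indicator sets_PiM_I_finite) auto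
    also have "\<dots> = emeasure P ?g ^ l"
      using tube_section[OF x] by (subst Q.emeasure_PiM) auto
    also have "\<dots> = ennreal ((1 - risk N x) ^ l)"
      by (simp add: risk_eq[OF x] emeasure_eq_measure ennreal_power)
    finally show "(\<integral>\<^sup>+y. indicator ?S (merge {..<N} ?J (x, y)) \<partial>PiM ?J (\<lambda>_. P)) =
        ennreal ((1 - risk N x) ^ l)" .
  qed
  finally have "measure (PP (N + l)) ?S = enn2real (\<integral>\<^sup>+x. ennreal ((1 - risk N x) ^ l) \<partial>PP N)"
    by (simp add: measure_def)
  also have "\<dots> = (\<integral>f. (1 - risk N f) ^ l \<partial>PP N)"
    by (rule integral_eq_nn_integral[symmetric]) (auto simp: risk_bounds)
  finally show ?thesis .
qed

lemma prob_satisfied: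
  assumes I: "I \<subseteq> {..<n}" and L: "L \<subseteq> {..<n} - I"
  shows "measure (PP n) {f \<in> space (PP n). \<forall>j\<in>L. f j \<in> G (map f (sorted_list_of_set I))} =
    (\<integral>f. (1 - risk (card I) f) ^ card L \<partial>PP (card I))"
proof -
  \<comment> \<open>Listing \<open>I\<close> first and then \<open>L\<close> moves the calibration
    indices to the front and the tested ones directly behind them, which is the situation of
    \<open>prob_fresh_satisfied\<close>.\<close>
  define xs where "xs = sorted_list_of_set I @ sorted_list_of_set L"
  have fin: "finite I" "finite L" using assms finite_subset by blast+
  have xs: "distinct xs" "set xs \<subseteq> {..<n}" using assms fin by (auto simp: xs_def)
  have len: "length xs = card I + card L" by (simp add: xs_def)
  let ?\<phi> = "\<lambda>f. \<lambda>i\<in>{..<length xs}. f (xs ! i)"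
  let ?S = "{f \<in> space (PP (length xs)). \<forall>j\<in>{card I..<card I + card L}. f j \<in> G (map f [0..<card I])}"
  have S: "?S \<in> sets (PP (length xs))" by (simp only: len) (measurable, auto)
  have \<phi>: "?\<phi> \<in> PP n \<rightarrow>\<^sub>M PP (length xs)" by (rule measurable_reindex[OF xs(2)])
  have "measure (PP (length xs)) ?S = measure (distr (PP n) (PP (length xs)) ?\<phi>) ?S"
    by (simp only: distr_reindex[OF xs])
  also have "\<dots> = measure (PP n) (?\<phi> -` ?S \<inter> space (PP n))"
    by (rule measure_distr[OF \<phi> S])
  also have "?\<phi> -` ?S \<inter> space (PP n) = {f \<in> space (PP n). \<forall>j\<in>L. f j \<in> G (map f (sorted_list_of_set I))}"
  proof -
    have "?\<phi> f \<in> ?S \<longleftrightarrow> (\<forall>j\<in>L. f j \<in> G (map f (sorted_list_of_set I)))" if f: "f \<in> space (PP n)" for f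
    proof -
      have m: "map (?\<phi> f) [0..<card I] = map f (sorted_list_of_set I)"
        by (rule nth_equalityI) (auto simp: len xs_def nth_append)
      have all: "(\<forall>j\<in>{card I..<card I + card L}. Q (?\<phi> f j)) \<longleftrightarrow> (\<forall>j\<in>L. Q (f j))" for Q
      proof -
        have "(\<forall>j\<in>{card I..<card I + card L}. Q (?\<phi> f j)) \<longleftrightarrow>
            (\<forall>k<card L. Q (?\<phi> f (card I + k)))"
          by (metis add_less_cancel_left atLeastLessThan_iff le_add1 le_Suc_ex)
        also have "\<dots> \<longleftrightarrow> (\<forall>k<card L. Q (f (sorted_list_of_set L ! k)))"
          by (simp add: len xs_def nth_append)
        also have "\<dots> \<longleftrightarrow> (\<forall>j\<in>set (sorted_list_of_set L). Q (f j))"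
          by (simp add: all_set_conv_all_nth)
        finally show ?thesis using fin by simp
      qed
      have "?\<phi> f \<in> ?S \<longleftrightarrow>
          (\<forall>j\<in>{card I..<card I + card L}. ?\<phi> f j \<in> G (map f (sorted_list_of_set I)))"
        by (simp only: mem_Collect_eq m measurable_space[OF \<phi> f] simp_thms)
      also have "\<dots> \<longleftrightarrow> (\<forall>j\<in>L. f j \<in> G (map f (sorted_list_of_set I)))"
        by (rule all[of "\<lambda>z. z \<in> G (map f (sorted_list_of_set I))"])
      finally show ?thesis .
    qed
    then show ?thesis unfolding vimage_def Int_def mem_Collect_eq by (metis (no_types, lifting))
  qed
  finally show ?thesis using prob_fresh_satisfied[of "card I" "card L"] by (simp only: len)
qed

section \<open>Law of the number of violators\<close>

definition violators :: "nat \<Rightarrow> (nat \<Rightarrow> 'a) \<Rightarrow> nat set \<Rightarrow> nat set" where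
  "violators n f I = {j \<in> {..<n} - I. f j \<notin> G (map f (sorted_list_of_set I))}"

text \<open>The event is a finite union over the possible violator sets \<open>D\<close>, each
  described by finitely many membership events.\<close>

lemma measurable_card_violators:
  assumes "I \<subseteq> {..<n}"
  shows "Measurable.pred (PP n) (\<lambda>f. card (violators n f I) = d)"
proof -
  let ?J = "{..<n} - I"
  have "set (sorted_list_of_set I) \<subseteq> {..<n}" using assms finite_subset[OF assms] by simp
  then have "Measurable.pred (PP n) (\<lambda>f. \<exists>D\<in>{D. D \<subseteq> ?J \<and> card D = d}. \<forall>j\<in>?J.
      (f j \<notin> G (map f (sorted_list_of_set I))) = (j \<in> D))"
    by (intro pred_intros_finite pred_intros_logic measurable_mem) auto
  also have "(\<lambda>f. \<exists>D\<in>{D. D \<subseteq> ?J \<and> card D = d}. \<forall>j\<in>?J.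
      (f j \<notin> G (map f (sorted_list_of_set I))) = (j \<in> D)) = (\<lambda>f. card (violators n f I) = d)"
  proof (intro ext iffI)
    fix f assume "\<exists>D\<in>{D. D \<subseteq> ?J \<and> card D = d}. \<forall>j\<in>?J. (f j \<notin> G (map f (sorted_list_of_set I))) = (j \<in> D)"
    then obtain D where D: "D \<subseteq> ?J" "card D = d"
      "\<forall>j\<in>?J. (f j \<notin> G (map f (sorted_list_of_set I))) = (j \<in> D)" by blast
    then have "violators n f I = D" unfolding violators_def by blast
    then show "card (violators n f I) = d" using D by simp
  next
    fix f assume "card (violators n f I) = d"
    then show "\<exists>D\<in>{D. D \<subseteq> ?J \<and> card D = d}. \<forall>j\<in>?J. (f j \<notin> G (map f (sorted_list_of_set I))) = (j \<in> D)"
      by (intro bexI[of _ "violators n f I"]) (auto simp: violators_def)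
  qed
  finally show ?thesis .
qed

text \<open>Given the sample on \<open>I\<close>, the number of violators is binomial with
  parameters \<open>m\<close> and the risk. This mixture is identified through its binomial moments:
  the expected number of \<open>l\<close>-sets of nonviolators is computed with
  \<open>prob_satisfied\<close>.\<close>

lemma integral_card_violators:
  assumes I: "I \<subseteq> {..<N + m}" "card I = N"
  shows "integrable (PP (N + m)) (\<lambda>f. g (card (violators (N + m) f I)))" (is ?int)
    and "(\<integral>f. g (card (violators (N + m) f I)) \<partial>PP (N + m)) =
      (\<integral>f. (\<Sum>d\<le>m. g d * Bernstein m d (risk N f)) \<partial>PP N)" (is ?eq)
proof -
  let ?n = "N + m" and ?v = "\<lambda>f. card (violators (N + m) f I)"
  interpret n: prob_space "PP ?n" by (rule prob_space_PP)
  interpret N: prob_space "PP N" by (rule prob_space_PP)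
  have finI: "finite I" using I finite_subset by blast
  have v_le: "?v f \<le> m" for f
  proof -
    have "?v f \<le> card ({..<?n} - I)" by (intro card_mono) (auto simp: violators_def)
    then show ?thesis using I finI by (simp add: card_Diff_subset)
  qed
  have [measurable]: "Measurable.pred (PP ?n) (\<lambda>f. ?v f = d)" for d
    by (rule measurable_card_violators[OF I(1)])
  define c where "c d = measure (PP ?n) {f \<in> space (PP ?n). ?v f = d}" for d
  define c' where "c' d = (\<integral>f. Bernstein m d (risk N f) \<partial>PP N)" for d
  define A where "A d = {f \<in> space (PP ?n). ?v f = d}" for d
  have A: "A d \<in> sets (PP ?n)" for d unfolding A_def by measurable
  \<comment> \<open>The count takes only values in \<open>0..m\<close>, so each function of it is a
    finite combination of indicators, and expectations reduce to the weights
    \<open>c d\<close>.\<close>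
  have expand: "h (?v f) = (\<Sum>d\<le>m. h d * indicator (A d) f)"
    if "f \<in> space (PP ?n)" for f and h :: "nat \<Rightarrow> real"
  proof -
    have "(\<Sum>d\<le>m. h d * indicator (A d) f) = (\<Sum>d\<le>m. if d = ?v f then h d else 0)"
      using that by (intro sum.cong) (auto simp: indicator_def A_def)
    then show ?thesis using v_le[of f] by simp
  qed
  have intA: "integrable (PP ?n) (\<lambda>f. h d * indicator (A d) f)" for h :: "nat \<Rightarrow> real" and d
    by (intro integrable_mult_right integrable_real_indicator A) (simp add: less_top[symmetric])
  have int: "integrable (PP ?n) (\<lambda>f. h (?v f))" for h :: "nat \<Rightarrow> real"
  proof (rule Bochner_Integration.integrable_cong[OF refl, THEN iffD2])
    show "integrable (PP ?n) (\<lambda>f. \<Sum>d\<le>m. h d * indicator (A d) f)"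
      by (rule Bochner_Integration.integrable_sum) (rule intA)
  qed (rule expand)
  have c: "(\<integral>f. h (?v f) \<partial>PP ?n) = (\<Sum>d\<le>m. c d * h d)" for h :: "nat \<Rightarrow> real"
  proof -
    have "(\<integral>f. h (?v f) \<partial>PP ?n) = (\<integral>f. (\<Sum>d\<le>m. h d * indicator (A d) f) \<partial>PP ?n)"
      by (rule Bochner_Integration.integral_cong[OF refl]) (rule expand)
    also have "\<dots> = (\<Sum>d\<le>m. (\<integral>f. h d * indicator (A d) f \<partial>PP ?n))"
      by (rule Bochner_Integration.integral_sum) (rule intA)
    also have "\<dots> = (\<Sum>d\<le>m. c d * h d)"
      using sets.sets_into_space[OF A] by (simp add: c_def A_def Int_absorb2 mult.commute)
    finally show ?thesis .
  qed
  have intB: "integrable (PP N) (\<lambda>f. Bernstein m d (risk N f))" for d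
  proof (rule N.integrable_const_bound[where B = "real (m choose d)"])
    show "AE f in PP N. norm (Bernstein m d (risk N f)) \<le> real (m choose d)"
      using risk_bounds[of N]
      by (auto simp: Bernstein_def abs_mult mult.assoc intro!: mult_left_le mult_le_one power_le_one)
  qed (simp add: Bernstein_def)
  have c': "(\<integral>f. (\<Sum>d\<le>m. h d * Bernstein m d (risk N f)) \<partial>PP N) = (\<Sum>d\<le>m. c' d * h d)" for h
    by (simp add: intB c'_def mult.commute)
  have "c d = c' d" if "d \<le> m" for d
  proof (rule binomial_moments_determine[OF _ that])
    fix l assume l: "l \<le> m"
    let ?L = "{L. L \<subseteq> {..<?n} - I \<and> card L = l}"
    let ?S = "\<lambda>L. {f \<in> space (PP ?n). \<forall>j\<in>L. f j \<in> G (map f (sorted_list_of_set I))}"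
    have cJ: "card ({..<?n} - I) = m" using I finI by (simp add: card_Diff_subset)
    have finL: "finite ?L" by (rule finite_subset[of _ "Pow {..<?n}"]) auto
    have S: "?S L \<in> sets (PP ?n)" if "L \<in> ?L" for L
    proof -
      have L: "L \<subseteq> {..<?n} - I" using that by simp
      then have "finite L" by (rule finite_subset) simp
      then have "Measurable.pred (PP ?n) (\<lambda>f. \<forall>j\<in>L. f j \<in> G (map f (sorted_list_of_set I)))"
        using I finI L by (intro pred_intros_finite measurable_mem) auto
      then show ?thesis unfolding pred_def .
    qed
    have "(\<Sum>d\<le>m. c d * real ((m - d) choose l)) = (\<integral>f. real ((m - ?v f) choose l) \<partial>PP ?n)"
      using c[of "\<lambda>d. real ((m - d) choose l)"] by simp
    \<comment> \<open>The binomial coefficient counts the \<open>l\<close>-sets \<open>L\<close>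
      outside \<open>I\<close> without violators; its expectation is then a sum of probabilities,
      all equal because they depend on \<open>L\<close> only via \<open>card L\<close>.\<close>
    also have "\<dots> = (\<integral>f. (\<Sum>L\<in>?L. indicator (?S L) f) \<partial>PP ?n)"
    proof (rule Bochner_Integration.integral_cong[OF refl])
      fix f assume f: "f \<in> space (PP ?n)"
      let ?J = "{..<?n} - I - violators ?n f I"
      have "card ?J = m - ?v f"
        using cJ by (subst card_Diff_subset) (auto simp: violators_def)
      then have "(m - ?v f) choose l = card {L. L \<subseteq> ?J \<and> card L = l}"
        using n_subsets[of ?J l] by simp
      also have "{L. L \<subseteq> ?J \<and> card L = l} = {L \<in> ?L. f \<in> ?S L}"
        using f by (auto simp: violators_def)
      finally show "real ((m - ?v f) choose l) = (\<Sum>L\<in>?L. indicator (?S L) f)"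
        by (simp only: real_of_card sum.inter_filter[OF finL] indicator_def of_bool_def)
    qed
    also have "\<dots> = (\<Sum>L\<in>?L. measure (PP ?n) (?S L))"
    proof -
      have "integrable (PP ?n) (indicat_real (?S L))" if "L \<in> ?L" for L
        by (intro integrable_real_indicator S that) (simp add: less_top[symmetric])
      then have "(\<integral>f. (\<Sum>L\<in>?L. indicat_real (?S L) f) \<partial>PP ?n) =
          (\<Sum>L\<in>?L. (\<integral>f. indicat_real (?S L) f \<partial>PP ?n))"
        by (rule Bochner_Integration.integral_sum)
      also have "\<dots> = (\<Sum>L\<in>?L. measure (PP ?n) (?S L))"
        by (intro sum.cong refl) (simp add: Int_absorb2)
      finally show ?thesis .
    qed
    also have "\<dots> = (\<Sum>L\<in>?L. (\<integral>f. (1 - risk N f) ^ l \<partial>PP N))"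
      using prob_satisfied[OF I(1)] I(2) by (intro sum.cong) auto
    also have "\<dots> = real (m choose l) * (\<integral>f. (1 - risk N f) ^ l \<partial>PP N)"
      using n_subsets[of "{..<?n} - I" l] cJ by simp
    also have "\<dots> = (\<integral>f. (\<Sum>d\<le>m. real ((m - d) choose l) * Bernstein m d (risk N f)) \<partial>PP N)"
    proof -
      have "(\<Sum>d\<le>m. real ((m - d) choose l) * Bernstein m d x) = real (m choose l) * (1 - x) ^ l" for x
        using sum_Bernstein_binomial[OF l, of x] by (simp add: mult.commute)
      then show ?thesis by simp
    qed
    also have "\<dots> = (\<Sum>d\<le>m. c' d * real ((m - d) choose l))"
      by (rule c')
    finally show "(\<Sum>d\<le>m. c d * real ((m - d) choose l)) = (\<Sum>d\<le>m. c' d * real ((m - d) choose l))" .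
  qed
  then show ?eq unfolding c c' by simp
  show ?int by (rule int)
qed

end

section \<open>Boundaries of subsamples and the limit\<close>

lemma nths_upt_sorted_list_of_set:
  assumes "A \<subseteq> {..<n}"
  shows "nths [0..<n] A = sorted_list_of_set A"
proof (rule sorted_distinct_set_unique)
  have "finite A" using assms finite_subset by blast
  have "x \<in> set (nths [0..<n] A) \<longleftrightarrow> x \<in> A" for x
  proof -
    have "x \<in> set (nths [0..<n] A) \<longleftrightarrow> (\<exists>i. i < n \<and> i \<in> A \<and> x = [0..<n] ! i)"
      by (auto simp: set_nths)
    also have "\<dots> \<longleftrightarrow> x \<in> A" using assms by (auto cong: conj_cong)
    finally show ?thesis .
  qed
  then show "set (nths [0..<n] A) = set (sorted_list_of_set A)"
    using \<open>finite A\<close> by auto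
qed (auto simp: sorted_nths)

text \<open>The boundary map returns positions within the subtuple on \<open>K\<close>; translated
  back to indices of \<open>f\<close>, boundaries belonging to different \<open>K\<close> become
  comparable as sets.\<close>

definition boundary_in :: "('a list \<Rightarrow> nat set) \<Rightarrow> (nat \<Rightarrow> 'a) \<Rightarrow> nat set \<Rightarrow> nat set" where
  "boundary_in B f K = (\<lambda>k. sorted_list_of_set K ! k) ` B (map f (sorted_list_of_set K))"

lemma boundary_in_subset_card:
  assumes "boundary_map B" "finite K"
  shows "boundary_in B f K \<subseteq> K" "card (boundary_in B f K) = card (B (map f (sorted_list_of_set K)))"
proof -
  have sub: "B (map f (sorted_list_of_set K)) \<subseteq> {..<card K}"
    using assms(1) by (simp add: boundary_map_def) (metis length_map length_sorted_list_of_set)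
  then show "boundary_in B f K \<subseteq> K"
    using assms(2) nth_mem[of _ "sorted_list_of_set K"] by (force simp: boundary_in_def)
  have "inj_on ((!) (sorted_list_of_set K)) {..<card K}"
    by (simp add: inj_on_def nth_eq_iff_index_eq)
  then show "card (boundary_in B f K) = card (B (map f (sorted_list_of_set K)))"
    unfolding boundary_in_def using sub by (intro card_image) (rule inj_on_subset)
qed

text \<open>A split of the subtuple on \<open>K\<close> is made at positions, while the counting
  argument needs sets of indices of the full tuple. The work lies in matching the two labelings;
  equivalence and projectivity then carry over.\<close>

lemma boundary_in_subset_iff:
  assumes B: "boundary_map B" and I: "I \<subseteq> K" and K: "K \<subseteq> {..<n}" and s: "s \<le> card I"
    and split: "\<forall>I\<subseteq>{..<card K}. s \<le> card I \<longrightarrow>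
      boundary_equivalence E A B (map f (sorted_list_of_set K)) I \<and>
      projectivity B (map f (sorted_list_of_set K)) I"
  shows "(\<forall>j\<in>K - I. f j \<in> E (A (map f (sorted_list_of_set I)))) \<longleftrightarrow> boundary_in B f K \<subseteq> I"
    and "boundary_in B f K \<subseteq> I \<Longrightarrow> boundary_in B f I = boundary_in B f K"
proof -
  have "finite K" using K by (rule finite_subset) simp
  moreover have "finite I" using I \<open>finite K\<close> by (rule finite_subset)
  ultimately have fin: "finite K" "finite I" .
  define ks where "ks = sorted_list_of_set K"
  define I' where "I' = {p. p < card K \<and> ks ! p \<in> I}"
  have ks: "set ks = K" "length ks = card K" "distinct ks" "sorted ks" using fin by (auto simp: ks_def)
  have I': "I' \<subseteq> {..<card K}" by (auto simp: I'_def)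
  have nths: "nths ks I' = sorted_list_of_set I"
  proof (rule sorted_distinct_set_unique)
    have "set (nths ks I') = K \<inter> I"
      using ks by (auto simp: set_nths I'_def in_set_conv_nth)
    then show "set (nths ks I') = set (sorted_list_of_set I)" using I fin by auto
  qed (use ks in \<open>auto simp: sorted_nths distinct_nthsI\<close>)
  \<comment> \<open>\<open>I'\<close> holds the positions of the elements of \<open>I\<close> in the
    sorted list of \<open>K\<close>. Looking up a position in \<open>I'\<close> and then in
    \<open>K\<close> is the same as looking it up directly in \<open>I\<close>, so the nested
    relabelings agree.\<close>
  have slI: "sorted_list_of_set I = map ((!) ks) (sorted_list_of_set I')"
  proof -
    have "nths ks I' = map ((!) ks) (nths [0..<card K] I')"
      by (metis ks(2) map_nth nths_map)
    then show ?thesis using nths nths_upt_sorted_list_of_set[OF I'] by simp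
  qed
  have cI': "card I' = card I"
    using arg_cong[OF slI, of length] by simp
  have T: "nths (map f ks) I' = map f (sorted_list_of_set I)"
    by (simp add: nths_map nths)
  have Bks: "B (map f ks) \<subseteq> {..<card K}"
    using B ks(2) unfolding boundary_map_def by (metis length_map)
  have sub: "B (map f ks) \<subseteq> I' \<longleftrightarrow> boundary_in B f K \<subseteq> I"
    using Bks by (auto simp: boundary_in_def I'_def ks_def)
  have split': "boundary_equivalence E A B (map f ks) I'" "projectivity B (map f ks) I'"
    using split I' s cI' by (auto simp: ks_def)
  have "(\<forall>j\<in>K - I. f j \<in> E (A (map f (sorted_list_of_set I)))) \<longleftrightarrow>
      (\<forall>p\<in>{..<card K} - I'. f (ks ! p) \<in> E (A (map f (sorted_list_of_set I))))"
  proof -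
    have "K - I = (!) ks ` ({..<card K} - I')"
      using ks(1,2) by (auto simp: I'_def in_set_conv_nth image_iff)
    then show ?thesis by simp
  qed
  then show "(\<forall>j\<in>K - I. f j \<in> E (A (map f (sorted_list_of_set I)))) \<longleftrightarrow> boundary_in B f K \<subseteq> I"
    using split'(1) sub ks(2) by (simp add: boundary_equivalence_def T)
  assume "boundary_in B f K \<subseteq> I"
  then have "(\<lambda>k. sorted_list_of_set I' ! k) ` B (map f (sorted_list_of_set I)) = B (map f ks)"
    using split'(2) sub by (simp add: projectivity_def T)
  then have "boundary_in B f K =
      (\<lambda>k. ks ! (sorted_list_of_set I' ! k)) ` B (map f (sorted_list_of_set I))"
    unfolding boundary_in_def ks_def[symmetric] by (metis image_image)
  also have "\<dots> = boundary_in B f I"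
    unfolding boundary_in_def
  proof (rule image_cong[OF refl])
    fix k assume "k \<in> B (map f (sorted_list_of_set I))"
    then have "k < card I"
      using B unfolding boundary_map_def by (metis length_map length_sorted_list_of_set lessThan_iff subsetD)
    then show "ks ! (sorted_list_of_set I' ! k) = sorted_list_of_set I ! k"
      by (simp add: slI cI')
  qed
  finally show "boundary_in B f I = boundary_in B f K" by simp
qed

section \<open>Recovering tail probabilities from Bernstein polynomials\<close>

lemma integral_Bernstein_LIMSEQ:
  fixes g :: "real \<Rightarrow> real"
  assumes D: "prob_space D" "sets D = sets borel" "AE x in D. x \<in> {0..1}" and g: "continuous_on UNIV g"
  shows "(\<lambda>m. \<integral>x. (\<Sum>d\<le>m. g (real d / real m) * Bernstein m d x) \<partial>D) \<longlonglongrightarrow> (\<integral>x. g x \<partial>D)"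
proof (rule LIMSEQ_I)
  interpret prob_space D by fact
  fix e :: real assume e: "0 < e"
  \<comment> \<open>Bernstein polynomials converge uniformly on the unit interval, where
    \<open>D\<close> is concentrated. The bound is \<open>e / 2\<close> because the integral
    estimate below is not strict.\<close>
  obtain M where M: "\<And>m x. M \<le> m \<Longrightarrow> x \<in> {0..1} \<Longrightarrow>
      \<bar>g x - (\<Sum>d\<le>m. g (real d / real m) * Bernstein m d x)\<bar> < e / 2"
    using Bernstein_Weierstrass[OF continuous_on_subset[OF g], of "e / 2"] e by auto
  show "\<exists>M. \<forall>m\<ge>M. norm ((\<integral>x. (\<Sum>d\<le>m. g (real d / real m) * Bernstein m d x) \<partial>D) - (\<integral>x. g x \<partial>D)) < e"
  proof (intro exI allI impI)
    fix m assume m: "M \<le> m"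
    let ?B = "\<lambda>x. \<Sum>d\<le>m. g (real d / real m) * Bernstein m d x"
    have intB: "integrable D ?B"
      by (intro integrable_continuous_unit[OF D] continuous_intros continuous_on_Bernstein)
    have intg: "integrable D g" by (rule integrable_continuous_unit[OF D g])
    have "norm ((\<integral>x. ?B x \<partial>D) - (\<integral>x. g x \<partial>D)) = norm (\<integral>x. ?B x - g x \<partial>D)"
      using intB intg by simp
    also have "\<dots> \<le> (\<integral>x. norm (?B x - g x) \<partial>D)" by (rule integral_norm_bound)
    also have "\<dots> \<le> (\<integral>x. e / 2 \<partial>D)"
    proof (rule integral_mono_AE)
      show "AE x in D. norm (?B x - g x) \<le> e / 2"
        using D(3)
      proof eventually_elim
        case (elim x)
        then show ?case using M[OF m elim] by (simp add: abs_minus_commute)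
      qed
      show "integrable D (\<lambda>x. norm (?B x - g x))" using intB intg by simp
    qed simp
    also have "\<dots> < e" using e prob_space by simp
    finally show "norm ((\<integral>x. ?B x \<partial>D) - (\<integral>x. g x \<partial>D)) < e" .
  qed
qed

text \<open>The ramps are bounded by 1, vanish up to \<open>\<epsilon>\<close> and eventually equal
  1 at each point beyond it, so dominated convergence applies. Being continuous, they are accessible
  to Bernstein approximation.\<close>

lemma integral_ramp_LIMSEQ:
  assumes D: "prob_space D" "sets D = sets borel"
  shows "(\<lambda>k. \<integral>x. min 1 (max 0 (real k * (x - \<epsilon>))) \<partial>D) \<longlonglongrightarrow> measure D {\<epsilon><..}"
proof -
  interpret prob_space D by fact
  have [measurable_cong]: "sets D = sets borel" by fact
  have "(\<lambda>k. \<integral>x. min 1 (max 0 (real k * (x - \<epsilon>))) \<partial>D) \<longlonglongrightarrow> (\<integral>x. indicator {\<epsilon><..} x \<partial>D)"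
  proof (rule integral_dominated_convergence[where w = "\<lambda>_. 1"])
    show "AE x in D. (\<lambda>k. min 1 (max 0 (real k * (x - \<epsilon>)))) \<longlonglongrightarrow> indicator {\<epsilon><..} x"
    proof (rule AE_I2)
      fix x
      show "(\<lambda>k. min 1 (max 0 (real k * (x - \<epsilon>)))) \<longlonglongrightarrow> indicator {\<epsilon><..} x"
      proof (cases "\<epsilon> < x")
        case True
        have "eventually (\<lambda>k. min 1 (max 0 (real k * (x - \<epsilon>))) = 1) sequentially"
        proof -
          obtain K where K: "1 < real K * (x - \<epsilon>)"
            using True reals_Archimedean3[of "x - \<epsilon>"] by auto
          have "min 1 (max 0 (real k * (x - \<epsilon>))) = 1" if "K \<le> k" for k
          proof -
            have "real K * (x - \<epsilon>) \<le> real k * (x - \<epsilon>)" using True that by (intro mult_right_mono) auto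
            then show ?thesis using K by simp
          qed
          then show ?thesis by (auto simp: eventually_sequentially)
        qed
        then show ?thesis using True by (simp add: tendsto_eventually)
      next
        case False
        then have "max 0 (real k * (x - \<epsilon>)) = 0" for k
          by (intro max_absorb1 mult_nonneg_nonpos) auto
        then have "min 1 (max 0 (real k * (x - \<epsilon>))) = 0" for k by simp
        then show ?thesis using False by simp
      qed
    qed
  qed auto
  also have "(\<integral>x. indicator {\<epsilon><..} x \<partial>D) = measure D {\<epsilon><..}"
    using sets_eq_imp_space_eq[OF D(2)] by simp
  finally show ?thesis .
qed

text \<open>The counting argument yields integrals of Bernstein sums with monotone coefficients.
  Ramps are monotone, so their values at \<open>d / m\<close> qualify; first \<open>m\<close> and
  then the slope \<open>k\<close> tends to infinity.\<close>

lemma measure_greaterThan_mono: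
  assumes D: "prob_space D" "sets D = sets borel" "AE x in D. x \<in> {0..1}"
    and D': "prob_space D'" "sets D' = sets borel" "AE x in D'. x \<in> {0..1}"
    and le: "\<And>m g. mono g \<Longrightarrow> (\<integral>x. (\<Sum>d\<le>m. g d * Bernstein m d x) \<partial>D) \<le> (\<integral>x. (\<Sum>d\<le>m. g d * Bernstein m d x) \<partial>D')"
  shows "measure D {\<epsilon><..} \<le> measure D' {\<epsilon><..}"
proof (rule LIMSEQ_le[OF integral_ramp_LIMSEQ[OF D(1,2)] integral_ramp_LIMSEQ[OF D'(1,2)]], intro exI allI impI)
  fix k :: nat
  let ?g = "\<lambda>x. min 1 (max 0 (real k * (x - \<epsilon>)))"
  have cont: "continuous_on UNIV ?g" by (intro continuous_intros)
  have mono: "mono (\<lambda>d. ?g (real d / real m))" for m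
    by (intro monoI min.mono max.mono mult_left_mono diff_mono divide_right_mono) auto
  show "(\<integral>x. ?g x \<partial>D) \<le> (\<integral>x. ?g x \<partial>D')"
    by (rule LIMSEQ_le[OF integral_Bernstein_LIMSEQ[OF D cont] integral_Bernstein_LIMSEQ[OF D' cont]])
      (intro exI allI impI le mono)
qed

section \<open>Comparing the law of the risk with the Beta law\<close>

context list_tube
begin

text \<open>The scheme properties come with a separate null set for each length; a tuple of length
  \<open>n\<close> has only finitely many subtuples, so one null set serves all of them.\<close>

lemma AE_splits:
  assumes "\<forall>n\<ge>s. AE f in PP n. Q (map f [0..<n])"
  shows "AE f in PP n. \<forall>K\<in>{K. K \<subseteq> {..<n} \<and> s \<le> card K}. Q (map f (sorted_list_of_set K))"
proof (rule AE_finite_allI)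
  show "finite {K. K \<subseteq> {..<n} \<and> s \<le> card K}" by simp
  fix K assume "K \<in> {K. K \<subseteq> {..<n} \<and> s \<le> card K}"
  moreover from this have "finite K" by (auto intro: finite_subset)
  ultimately have K: "finite K" "K \<subseteq> {..<n}" "s \<le> card K" by auto
  have "AE g in PP (card K). Q (map g [0..<card K])"
    using assms K(3) by blast
  then show "AE f in PP n. Q (map f (sorted_list_of_set K))"
    using K(1,2) AE_reindex[of "sorted_list_of_set K" n Q]
    by (simp only: length_sorted_list_of_set distinct_sorted_list_of_set set_sorted_list_of_set simp_thms)
qed

lemma violators_disjoint_iff:
  assumes "boundary_map B" "I \<subseteq> K" "K \<subseteq> {..<n}" "s \<le> card I"
    and "\<forall>I\<subseteq>{..<card K}. s \<le> card I \<longrightarrow>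
      boundary_equivalence id G B (map f (sorted_list_of_set K)) I \<and>
      projectivity B (map f (sorted_list_of_set K)) I"
  shows "violators n f I \<inter> K = {} \<longleftrightarrow> boundary_in B f K \<subseteq> I"
  using boundary_in_subset_iff(1)[OF assms] assms(2,3) by (auto simp: violators_def)

text \<open>Since the trajectories are i.i.d., each of the \<open>(N + m) choose N\<close> sets
  \<open>I\<close> contributes the same integral.\<close>

lemma sum_card_violators:
  fixes g :: "nat \<Rightarrow> real"
  shows "(\<Sum>I | I \<subseteq> {..<N + m} \<and> card I = N. \<integral>f. g (card (violators (N + m) f I)) \<partial>PP (N + m)) =
    real ((N + m) choose N) * (\<integral>x. (\<Sum>d\<le>m. g d * Bernstein m d x) \<partial>distr (PP N) borel (risk N))"
proof -
  have meas: "(\<lambda>x. \<Sum>d\<le>m. g d * Bernstein m d x) \<in> borel_measurable borel"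
    by (intro borel_measurable_continuous_onI continuous_intros continuous_on_Bernstein)
  show ?thesis
    using n_subsets[of "{..<N + m}" N]
    by (simp add: integral_card_violators(2) integral_distr[OF measurable_risk meas])
qed

text \<open>The expectation of the sum over all \<open>I\<close> is found twice: as a multiple of
  \<open>?L\<close> by \<open>sum_card_violators\<close>, and as the same multiple of
  \<open>?R\<close> because the sum is almost surely constant by
  \<open>sum_violators_beta\<close>.\<close>

lemma integral_Bernstein_risk_eq:
  assumes s: "1 \<le> s" "s \<le> N" and B: "boundary_map B"
    and scheme: "\<forall>n\<ge>s. AE f in PP n. \<forall>I\<subseteq>{..<n}. s \<le> card I \<longrightarrow>
      boundary_equivalence id G B (map f [0..<n]) I \<and> projectivity B (map f [0..<n]) I \<and>
      card (B (map f [0..<n])) = s"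
  shows "(\<integral>x. (\<Sum>d\<le>m. g d * Bernstein m d x) \<partial>distr (PP N) borel (risk N)) =
    (\<integral>x. (\<Sum>d\<le>m. g d * Bernstein m d x) \<partial>beta_measure N s)" (is "?L = ?R")
proof -
  let ?n = "N + m"
  let ?F = "{I. I \<subseteq> {..<?n} \<and> card I = N}"
  interpret n: prob_space "PP ?n" by (rule prob_space_PP)
  have int: "integrable (PP ?n) (\<lambda>f. \<Sum>I\<in>?F. g (card (violators ?n f I)))"
    by (intro Bochner_Integration.integrable_sum integral_card_violators(1)) auto
  have "AE f in PP ?n. \<forall>K\<in>{K. K \<subseteq> {..<?n} \<and> s \<le> card K}. \<forall>I\<subseteq>{..<length (map f (sorted_list_of_set K))}. s \<le> card I \<longrightarrow>
      boundary_equivalence id G B (map f (sorted_list_of_set K)) I \<and>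
      projectivity B (map f (sorted_list_of_set K)) I \<and>
      card (B (map f (sorted_list_of_set K))) = s"
    using AE_splits[of s "\<lambda>T. \<forall>I\<subseteq>{..<length T}. s \<le> card I \<longrightarrow>
      boundary_equivalence id G B T I \<and> projectivity B T I \<and> card (B T) = s" ?n] scheme by simp
  then have "AE f in PP ?n. (\<Sum>I\<in>?F. g (card (violators ?n f I))) = real (?n choose N) * ?R"
  proof eventually_elim
    case (elim f)
    have fin: "finite K" if "K \<subseteq> {..<?n}" for K using that by (rule finite_subset) simp
    have split: "\<forall>I\<subseteq>{..<card K}. s \<le> card I \<longrightarrow>
      boundary_equivalence id G B (map f (sorted_list_of_set K)) I \<and>
      projectivity B (map f (sorted_list_of_set K)) I \<and>
      card (B (map f (sorted_list_of_set K))) = s" if "K \<subseteq> {..<?n}" "s \<le> card K" for K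
      using elim that by simp
    show ?case
    proof (rule sum_violators_beta[OF s, where b = "boundary_in B f"])
      fix K assume K: "K \<subseteq> {..<?n}" "N \<le> card K"
      \<comment> \<open>The size statement stands under the quantifier over splits; the full split
        \<open>{..<card K}\<close> extracts it.\<close>
      then have "card (B (map f (sorted_list_of_set K))) = s"
        using split[OF K(1), rule_format, of "{..<card K}"] s by simp
      then show "boundary_in B f K \<subseteq> K \<and> card (boundary_in B f K) = s"
        using boundary_in_subset_card[OF B fin[OF K(1)], of f] by simp
    next
      fix I K assume IK: "I \<subseteq> K" "K \<subseteq> {..<?n}" "card I = N"
      then have "s \<le> card K" using s card_mono[OF fin[OF IK(2)] IK(1)] by simp
      then show "violators ?n f I \<inter> K = {} \<longleftrightarrow> boundary_in B f K \<subseteq> I"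
        using split[of K] IK s by (intro violators_disjoint_iff[OF B]) auto
    qed (auto simp: violators_def)
  qed
  then have "(\<integral>f. (\<Sum>I\<in>?F. g (card (violators ?n f I))) \<partial>PP ?n) = (\<integral>f. real (?n choose N) * ?R \<partial>PP ?n)"
    using int by (intro integral_cong_AE) auto
  also have "\<dots> = real (?n choose N) * ?R"
    using n.prob_space by simp
  also have "(\<integral>f. (\<Sum>I\<in>?F. g (card (violators ?n f I))) \<partial>PP ?n) = real (?n choose N) * ?L"
    unfolding sum_card_violators[symmetric]
    by (intro Bochner_Integration.integral_sum integral_card_violators(1)) auto
  finally show ?thesis by simp
qed

text \<open>The argument is that of \<open>integral_Bernstein_risk_eq\<close> with enlarged violator
  sets in the pointwise count: their boundaries have size exactly \<open>s\<close>, and a monotone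
  \<open>g\<close> turns the additional violators into an upper bound.\<close>

lemma integral_Bernstein_risk_le:
  assumes s: "1 \<le> s" "s \<le> N" and B: "boundary_map B" and "mono g"
    and scheme: "\<forall>n\<ge>s. AE f in PP n. \<forall>I\<subseteq>{..<n}. s \<le> card I \<longrightarrow>
      boundary_equivalence id G B (map f [0..<n]) I \<and> projectivity B (map f [0..<n]) I"
    and card: "\<forall>T. card (B T) \<le> s"
  shows "(\<integral>x. (\<Sum>d\<le>m. g d * Bernstein m d x) \<partial>distr (PP N) borel (risk N)) \<le>
    (\<integral>x. (\<Sum>d\<le>m. g d * Bernstein m d x) \<partial>beta_measure N s)" (is "?L \<le> ?R")
proof -
  let ?n = "N + m"
  let ?F = "{I. I \<subseteq> {..<?n} \<and> card I = N}"
  interpret n: prob_space "PP ?n" by (rule prob_space_PP)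
  have int: "integrable (PP ?n) (\<lambda>f. \<Sum>I\<in>?F. g (card (violators ?n f I)))"
    by (intro Bochner_Integration.integrable_sum integral_card_violators(1)) auto
  have "AE f in PP ?n. \<forall>K\<in>{K. K \<subseteq> {..<?n} \<and> s \<le> card K}. \<forall>I\<subseteq>{..<length (map f (sorted_list_of_set K))}. s \<le> card I \<longrightarrow>
      boundary_equivalence id G B (map f (sorted_list_of_set K)) I \<and>
      projectivity B (map f (sorted_list_of_set K)) I"
    using AE_splits[of s "\<lambda>T. \<forall>I\<subseteq>{..<length T}. s \<le> card I \<longrightarrow>
      boundary_equivalence id G B T I \<and> projectivity B T I" ?n] scheme by simp
  then have "AE f in PP ?n. (\<Sum>I\<in>?F. g (card (violators ?n f I))) \<le> real (?n choose N) * ?R"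
  proof eventually_elim
    case (elim f)
    have fin: "finite K" if "K \<subseteq> {..<?n}" for K using that by (rule finite_subset) simp
    have split: "\<forall>I\<subseteq>{..<card K}. s \<le> card I \<longrightarrow>
      boundary_equivalence id G B (map f (sorted_list_of_set K)) I \<and>
      projectivity B (map f (sorted_list_of_set K)) I" if "I \<subseteq> K" "K \<subseteq> {..<?n}" "s \<le> card I" for I K
    proof -
      have "s \<le> card K" using that card_mono[OF fin[OF that(2)] that(1)] by simp
      then show ?thesis using elim that by simp
    qed
    \<comment> \<open>The enlargement is made separately for every \<open>f\<close>; its sum over
      \<open>I\<close> does not depend on \<open>f\<close>, so the resulting pointwise bound can be
      integrated.\<close>
    obtain viol' b' where v: "\<And>I. violators ?n f I \<subseteq> viol' I" "\<And>I. viol' I \<subseteq> {..<?n} - I"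
      "\<And>K. K \<subseteq> {..<?n} \<Longrightarrow> s \<le> card K \<Longrightarrow> b' K \<subseteq> K \<and> card (b' K) = s"
      "\<And>I K. I \<subseteq> K \<Longrightarrow> K \<subseteq> {..<?n} \<Longrightarrow> s \<le> card I \<Longrightarrow> viol' I \<inter> K = {} \<longleftrightarrow> b' K \<subseteq> I"
    proof (rule enlarge_boundary[of "{..<?n}" "violators ?n f" s "boundary_in B f"])
      show "violators ?n f I \<subseteq> {..<?n} - I" for I by (auto simp: violators_def)
      show "boundary_in B f K \<subseteq> K \<and> card (boundary_in B f K) \<le> s" if "K \<subseteq> {..<?n}" for K
        using boundary_in_subset_card[OF B fin[OF that], of f] card by simp
      show "violators ?n f I \<inter> K = {} \<longleftrightarrow> boundary_in B f K \<subseteq> I"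
        if "I \<subseteq> K" "K \<subseteq> {..<?n}" "s \<le> card I" for I K
        by (rule violators_disjoint_iff[OF B that split[OF that]])
      show "boundary_in B f I = boundary_in B f K"
        if "I \<subseteq> K" "K \<subseteq> {..<?n}" "s \<le> card I" "boundary_in B f K \<subseteq> I" for I K
        by (rule boundary_in_subset_iff(2)[OF B that(1-3) split[OF that(1-3)] that(4)])
    qed auto
    have "(\<Sum>I\<in>?F. g (card (violators ?n f I))) \<le> (\<Sum>I\<in>?F. g (card (viol' I)))"
    proof (rule sum_mono)
      fix I
      have "finite (viol' I)" using v(2)[of I] by (rule finite_subset) simp
      then show "g (card (violators ?n f I)) \<le> g (card (viol' I))"
        using v(1) by (intro monoD[OF \<open>mono g\<close>] card_mono)
    qed
    also have "\<dots> = real (?n choose N) * ?R"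
      using v(2-4) s by (intro sum_violators_beta[where b = b']) auto
    finally show ?case .
  qed
  then have "(\<integral>f. (\<Sum>I\<in>?F. g (card (violators ?n f I))) \<partial>PP ?n) \<le> (\<integral>f. real (?n choose N) * ?R \<partial>PP ?n)"
    by (intro integral_mono_AE int) auto
  also have "\<dots> = real (?n choose N) * ?R"
    using n.prob_space by simp
  also have "(\<integral>f. (\<Sum>I\<in>?F. g (card (violators ?n f I))) \<partial>PP ?n) = real (?n choose N) * ?L"
    unfolding sum_card_violators[symmetric]
    by (intro Bochner_Integration.integral_sum integral_card_violators(1)) auto
  finally show ?thesis by simp
qed

end

section \<open>The conditional violation risk\<close>

context list_tube
begin

lemma sets_fresh_violation:
  assumes A: "A \<in> sets (PP N)"
  shows "{h \<in> space (PP (Suc N)). restrict h {..<N} \<in> A \<and> h N \<notin> G (map h [0..<N])} \<in> sets (PP (Suc N))"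
proof -
  have rest: "(\<lambda>h. restrict h {..<N}) \<in> PP (Suc N) \<rightarrow>\<^sub>M PP N"
    by (intro measurable_restrict_subset) auto
  have "Measurable.pred (PP (Suc N)) (\<lambda>h. restrict h {..<N} \<in> A)"
    using measurable_sets[OF rest A] by (simp add: pred_def vimage_def Int_def conj_commute)
  moreover have "Measurable.pred (PP (Suc N)) (\<lambda>h. h N \<in> G (map h [0..<N]))"
    by (intro measurable_mem) auto
  ultimately show ?thesis
    unfolding pred_def[symmetric] by (intro pred_intros_logic)
qed

text \<open>This is the defining property of the conditional probability, carried over to the
  product space and obtained by integrating over the last coordinate first.\<close>

lemma prob_fresh_violation:
  assumes A: "A \<in> sets (PP N)"
  shows "measure (PP (Suc N)) {h \<in> space (PP (Suc N)). restrict h {..<N} \<in> A \<and> h N \<notin> G (map h [0..<N])} =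
    (\<integral>f. indicator A f * risk N f \<partial>PP N)"
proof -
  interpret Q: product_prob_space "\<lambda>_::nat. P" UNIV
    by unfold_locales
  let ?S = "{h \<in> space (PP (Suc N)). restrict h {..<N} \<in> A \<and> h N \<notin> G (map h [0..<N])}"
  let ?viol = "\<lambda>f. {y \<in> space P. y \<notin> G (map f [0..<N])}"
  have S: "?S \<in> sets (PP (Suc N))" by (rule sets_fresh_violation[OF A])
  have viol: "?viol f \<in> events" if "f \<in> space (PP N)" for f
    using sets.sets_Collect_neg[OF tube_section[OF that]] by simp
  have "emeasure (PP (Suc N)) ?S = (\<integral>\<^sup>+h. indicator ?S h \<partial>PiM (insert N {..<N}) (\<lambda>_. P))"
    using S by (simp add: lessThan_Suc)
  also have "\<dots> = (\<integral>\<^sup>+f. \<integral>\<^sup>+y. indicator ?S (f(N := y)) \<partial>P \<partial>PP N)"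
    using S by (intro Q.product_nn_integral_insert) (auto simp: lessThan_Suc)
  also have "\<dots> = (\<integral>\<^sup>+f. ennreal (indicator A f * risk N f) \<partial>PP N)"
  proof (rule nn_integral_cong)
    fix f assume f: "f \<in> space (PP N)"
    have "indicator ?S (f(N := y)) = indicator A f * (indicator (?viol f) y :: ennreal)"
      if y: "y \<in> space P" for y
    proof -
      have "f(N := y) \<in> space (PP (Suc N))"
        using f y by (auto simp: space_PiM PiE_def extensional_def Pi_def less_Suc_eq)
      moreover have "restrict (f(N := y)) {..<N} = f"
        using f by (auto simp: space_PiM PiE_def extensional_def fun_eq_iff)
      moreover have "map (f(N := y)) [0..<N] = map f [0..<N]" by simp
      ultimately have "f(N := y) \<in> ?S \<longleftrightarrow> f \<in> A \<and> y \<in> ?viol f"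
        using y by (simp only: mem_Collect_eq fun_upd_same simp_thms)
      then show ?thesis by (simp add: indicator_def)
    qed
    then have "(\<integral>\<^sup>+y. indicator ?S (f(N := y)) \<partial>P) = (\<integral>\<^sup>+y. indicator A f * indicator (?viol f) y \<partial>P)"
      by (intro nn_integral_cong) simp
    also have "\<dots> = indicator A f * emeasure P (?viol f)"
      using viol[OF f] by (simp add: nn_integral_cmult_indicator)
    also have "\<dots> = ennreal (indicator A f * risk N f)"
      by (simp add: risk_def emeasure_eq_measure indicator_def)
    finally show "(\<integral>\<^sup>+y. indicator ?S (f(N := y)) \<partial>P) = ennreal (indicator A f * risk N f)" .
  qed
  finally have "measure (PP (Suc N)) ?S = enn2real (\<integral>\<^sup>+f. ennreal (indicator A f * risk N f) \<partial>PP N)"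
    by (simp add: measure_def)
  also have "\<dots> = (\<integral>f. indicator A f * risk N f \<partial>PP N)"
    by (rule integral_eq_nn_integral[symmetric]) (use A in \<open>auto simp: risk_bounds\<close>)
  finally show ?thesis .
qed

lemma AE_risk_unit: "AE x in distr (PP N) borel (risk N). x \<in> {0..1}"
  by (subst AE_distr_iff) (auto simp: risk_bounds)

lemma prob_space_risk: "prob_space (distr (PP N) borel (risk N))"
  by (intro prob_space.prob_space_distr prob_space_PP measurable_risk)

end

text \<open>The risk, evaluated at the sample, is measurable for the sample algebra and has the same
  integrals over all its events as the violation indicator; that determines the conditional
  expectation almost everywhere.\<close>

lemma real_cond_exp_eq_risk:
  fixes X :: "nat \<Rightarrow> 'w \<Rightarrow> 'a::euclidean_space"
  assumes "prob_space M" and P: "list_tube P G" "sets P = sets borel"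
    and law: "\<And>n. 0 < n \<Longrightarrow> distr M (\<Pi>\<^sub>M i\<in>{..<n}. P) (\<lambda>\<omega>. \<lambda>i\<in>{..<n}. X i \<omega>) = (\<Pi>\<^sub>M i\<in>{..<n}. P)"
    and X: "\<And>i. X i \<in> borel_measurable M"
  shows "AE \<omega> in M. real_cond_exp M (sample_algebra M X N)
      (indicator {\<omega> \<in> space M. X N \<omega> \<notin> G (sample X N \<omega>)}) \<omega> =
    list_tube.risk P G N (\<lambda>i\<in>{..<N}. X i \<omega>)"
proof -
  interpret prob_space M by fact
  interpret L: list_tube P G by fact
  let ?F = "sample_algebra M X N"
  let ?r = "\<lambda>n \<omega>. \<lambda>i\<in>{..<n}. X i \<omega>"
  let ?g = "\<lambda>\<omega>. L.risk N (?r N \<omega>)"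
  have sets_PP: "sets (L.PP n) = sets (\<Pi>\<^sub>M i\<in>{..<n}. borel)" for n
    by (intro sets_PiM_cong refl P(2))
  have r: "?r n \<in> M \<rightarrow>\<^sub>M L.PP n" for n
    by (intro measurable_restrict) (use X P(2) in \<open>simp cong: measurable_cong_sets\<close>)
  have spaceP: "space P = UNIV" using sets_eq_imp_space_eq[OF P(2)] by simp
  have rF: "?r N \<in> ?F \<rightarrow>\<^sub>M L.PP N"
  proof -
    have "?r N \<in> ?F \<rightarrow>\<^sub>M (\<Pi>\<^sub>M i\<in>{..<N}. borel)"
      unfolding sample_algebra_def
      by (rule measurable_vimage_algebra1) (auto simp: space_PiM)
    then show ?thesis using sets_PP measurable_cong_sets by blast
  qed
  have subalg: "subalgebra M ?F"
    unfolding subalgebra_def sample_algebra_def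
  proof
    show "sets (vimage_algebra (space M) (?r N) (\<Pi>\<^sub>M i\<in>{..<N}. borel)) \<subseteq> sets M"
      using measurable_sets[OF r[of N]] sets_PP
      by (subst sets_vimage_algebra2) (auto simp: space_PiM)
  qed simp
  interpret finite_measure_subalgebra M ?F
    by unfold_locales (rule subalg)
  let ?V = "{\<omega> \<in> space M. X N \<omega> \<notin> G (sample X N \<omega>)}"
  let ?S = "\<lambda>A. {h \<in> space (L.PP (Suc N)). restrict h {..<N} \<in> A \<and> h N \<notin> G (map h [0..<N])}"
  \<comment> \<open>Violation together with a sample event is an event about the first
    \<open>N + 1\<close> trajectories, so its probability is read off from their product
    law.\<close>
  have pre: "?r (Suc N) -` ?S A \<inter> space M = {\<omega> \<in> space M. ?r N \<omega> \<in> A} \<inter> ?V" for A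
  proof -
    have "?r (Suc N) \<omega> \<in> ?S A \<longleftrightarrow> ?r N \<omega> \<in> A \<and> X N \<omega> \<notin> G (sample X N \<omega>)"
      if "\<omega> \<in> space M" for \<omega>
    proof -
      have "?r (Suc N) \<omega> \<in> space (L.PP (Suc N))" using that by (rule measurable_space[OF r])
      moreover have "restrict (?r (Suc N) \<omega>) {..<N} = ?r N \<omega>" by auto
      moreover have "map (?r (Suc N) \<omega>) [0..<N] = sample X N \<omega>" by (simp add: sample_def)
      moreover have "?r (Suc N) \<omega> N = X N \<omega>" by simp
      ultimately show ?thesis by (simp only: mem_Collect_eq simp_thms)
    qed
    then show ?thesis by blast
  qed
  have V: "?V \<in> sets M"
  proof -
    have "?V = ?r (Suc N) -` ?S (space (L.PP N)) \<inter> space M"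
      unfolding pre using measurable_space[OF r[of N]] by auto
    then show ?thesis using measurable_sets[OF r L.sets_fresh_violation[OF sets.top]] by simp
  qed
  have g: "?g \<in> borel_measurable ?F"
    by (rule measurable_compose[OF rF L.measurable_risk])
  have gM: "?g \<in> borel_measurable M"
    by (rule measurable_compose[OF r L.measurable_risk])
  \<comment> \<open>\<open>law\<close> speaks of positive lengths only. For \<open>N = 0\<close> the
    product space has a single point, so two probability measures on it agree.\<close>
  have law_N: "distr M (L.PP N) (?r N) = L.PP N"
  proof (cases "N = 0")
    case True
    interpret D: prob_space "distr M (L.PP N) (?r N)" by (rule prob_space_distr[OF r])
    show ?thesis unfolding True
    proof (rule measure_eqI)
      interpret P0: prob_space "L.PP 0" by (rule L.prob_space_PP)
      fix A assume "A \<in> sets (distr M (L.PP 0) (?r 0))"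
      then have "A = {} \<or> A = space (L.PP 0)"
        using sets.sets_into_space[of A "L.PP 0"] by (auto simp: space_PiM)
      then show "emeasure (distr M (L.PP 0) (?r 0)) A = emeasure (L.PP 0) A"
        using D.emeasure_space_1 P0.emeasure_space_1 by (auto simp: True)
    qed simp
  next
    case False
    then show ?thesis using law by simp
  qed
  show ?thesis
  proof (rule real_cond_exp_charact[OF _ _ _ g])
    show "integrable M (indicat_real ?V)"
      using V by (intro integrable_real_indicator) (auto simp: less_top[symmetric])
    show "integrable M ?g"
      using gM L.risk_bounds by (intro integrable_const_bound[where B = 1]) auto
    fix C assume "C \<in> sets ?F"
    then have "C \<in> {?r N -` A \<inter> space M |A. A \<in> sets (\<Pi>\<^sub>M i\<in>{..<N}. borel)}"
      unfolding sample_algebra_def by (subst (asm) sets_vimage_algebra2) (auto simp: space_PiM)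
    then obtain A where A: "A \<in> sets (L.PP N)" and C: "C = ?r N -` A \<inter> space M"
      unfolding sets_PP by blast
    have "(LINT \<omega>:C|M. indicat_real ?V \<omega>) = (\<integral>\<omega>. indicator (C \<inter> ?V) \<omega> \<partial>M)"
      unfolding set_lebesgue_integral_def by (intro Bochner_Integration.integral_cong refl) (auto simp: indicator_def)
    also have "\<dots> = measure M (?r (Suc N) -` ?S A \<inter> space M)"
      unfolding pre C by (simp add: Int_def conj_ac vimage_def)
    also have "\<dots> = measure (distr M (L.PP (Suc N)) (?r (Suc N))) (?S A)"
      by (rule measure_distr[symmetric, OF r L.sets_fresh_violation[OF A]])
    also have "\<dots> = (\<integral>f. indicator A f * L.risk N f \<partial>L.PP N)"
      unfolding law[OF zero_less_Suc] by (rule L.prob_fresh_violation[OF A])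
    also have "\<dots> = (\<integral>f. indicator A f * L.risk N f \<partial>distr M (L.PP N) (?r N))"
      unfolding law_N ..
    also have "\<dots> = (\<integral>\<omega>. indicator A (?r N \<omega>) * ?g \<omega> \<partial>M)"
      by (rule integral_distr[OF r]) (use A in measurable)
    also have "\<dots> = (LINT \<omega>:C|M. ?g \<omega>)"
      unfolding set_lebesgue_integral_def C by (intro Bochner_Integration.integral_cong refl) (auto simp: indicator_def)
    finally show "(LINT \<omega>:C|M. indicat_real ?V \<omega>) = (LINT \<omega>:C|M. ?g \<omega>)" .
  qed
qed

text \<open>The infimum is attained: the admissible levels form a closed set by continuity, and 1
  belongs to it because the tail vanishes there when \<open>s \<le> N\<close>.\<close>

lemma binomial_tail_risk_level:
  assumes "s \<le> N" "0 < \<beta>"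
  shows "risk_level N s \<beta> \<in> {0..1}" "binomial_tail N s (risk_level N s \<beta>) \<le> \<beta>"
proof -
  let ?S = "{\<epsilon> \<in> {0..1}. binomial_tail N s \<epsilon> \<le> \<beta>}"
  have "binomial_tail N s 1 = 0"
    unfolding binomial_tail_def using assms by (intro sum.neutral) auto
  then have "?S \<noteq> {}" using assms by (auto intro!: exI[of _ 1])
  moreover have "bdd_below ?S" by (rule bdd_belowI[of _ 0]) auto
  moreover have "closed ?S"
  proof -
    have "continuous_on {0..1} (binomial_tail N s)"
      unfolding binomial_tail_def[abs_def] by (intro continuous_intros)
    from continuous_closed_preimage[OF this, of "{..\<beta>}"] show ?thesis
      by (simp add: vimage_def Int_def)
  qed
  ultimately have "Inf ?S \<in> ?S" by (rule closed_contains_Inf)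
  then show "risk_level N s \<beta> \<in> {0..1}" "binomial_tail N s (risk_level N s \<beta>) \<le> \<beta>"
    by (simp_all add: risk_level_def)
qed

theorem theorem6:
  fixes M :: "'w measure"
    and X :: "nat \<Rightarrow> 'w \<Rightarrow> 'a::euclidean_space"
    and \<Theta> :: "'t set"
    and E :: "'t \<Rightarrow> 'a set"
    and A :: "'a list \<Rightarrow> 't"
    and B :: "'a list \<Rightarrow> nat set"
    and N :: nat
  assumes "prob_space M"
    and "iid_trajectories M X"
    and "tube_family \<Theta> E"
    and "tube_calibrator \<Theta> E A"
    and "boundary_map B"
  defines "P \<equiv> distr M borel (X 0)"
    and "V \<equiv> violation_risk M X E A N"
  shows
    "(\<forall>s\<in>{1..N}. proper_boundary_scheme P E A B s \<longrightarrow>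
        distributed M lborel V (\<lambda>x. ennreal (beta_density (real s) (real N - real s + 1) x)) \<and>
        (\<forall>\<epsilon>\<in>{0..1}. measure M {\<omega> \<in> space M. V \<omega> > \<epsilon>} = binomial_tail N s \<epsilon>) \<and>
        (\<forall>\<beta>\<in>{0<..<1}. measure M {\<omega> \<in> space M. V \<omega> \<le> risk_level N s \<beta>} \<ge> 1 - \<beta>)) \<and>
     (\<forall>sbar\<in>{1..N}. certified_boundary_complexity P E A B sbar \<longrightarrow>
        (\<forall>\<epsilon>\<in>{0..1}. measure M {\<omega> \<in> space M. V \<omega> > \<epsilon>} \<le> binomial_tail N sbar \<epsilon>) \<and>
        (\<forall>\<beta>\<in>{0<..<1}. measure M {\<omega> \<in> space M. V \<omega> \<le> risk_level N sbar \<beta>} \<ge> 1 - \<beta>))"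
proof -
  interpret prob_space M by fact
  define G where "G = (\<lambda>T. E (A T))"
  have indep: "indep_vars (\<lambda>_. borel) X UNIV" and ident: "\<And>i. distr M borel (X i) = P"
    using assms(2) unfolding iid_trajectories_def P_def by auto
  have X: "X i \<in> borel_measurable M" for i
    using indep by (simp add: indep_vars_def)
  have P_borel: "sets P = sets borel" by (simp add: P_def)
  have sets_PP: "sets (\<Pi>\<^sub>M i\<in>{..<n}. P) = sets (\<Pi>\<^sub>M i\<in>{..<n}. borel)" for n :: nat
    by (intro sets_PiM_cong refl P_borel)
  have "prob_space P" unfolding P_def by (rule prob_space_distr[OF X])
  have "list_tube P G"
  proof (intro list_tube.intro list_tube_axioms.intro \<open>prob_space P\<close>)
    fix n :: nat
    have pair: "sets ((\<Pi>\<^sub>M i\<in>{..<n}. P) \<Otimes>\<^sub>M P) = sets ((\<Pi>\<^sub>M i\<in>{..<n}. borel) \<Otimes>\<^sub>M borel)"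
      by (intro sets_pair_measure_cong sets_PP P_borel)
    show "{p \<in> space ((\<Pi>\<^sub>M i\<in>{..<n}. P) \<Otimes>\<^sub>M P). snd p \<in> G (map (fst p) [0..<n])}
        \<in> sets ((\<Pi>\<^sub>M i\<in>{..<n}. P) \<Otimes>\<^sub>M P)"
      unfolding pair sets_eq_imp_space_eq[OF pair] G_def
      using assms(4) by (simp add: tube_calibrator_def)
  qed
  then interpret L: list_tube P G .
  let ?r = "\<lambda>n \<omega>. \<lambda>i\<in>{..<n}. X i \<omega>"
  let ?D = "distr (L.PP N) borel (L.risk N)"
  have r: "?r n \<in> M \<rightarrow>\<^sub>M L.PP n" for n
    by (intro measurable_restrict) (use X P_borel in \<open>simp cong: measurable_cong_sets\<close>)
  have law: "distr M (L.PP n) (?r n) = L.PP n" if "0 < n" for n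
  proof -
    have "indep_vars (\<lambda>_. borel) X {..<n}"
      by (rule indep_vars_subset[OF indep]) simp
    then have "distr M (\<Pi>\<^sub>M i\<in>{..<n}. borel) (?r n) = (\<Pi>\<^sub>M i\<in>{..<n}. distr M borel (X i))"
      using that X by (subst (asm) indep_vars_iff_distr_eq_PiM) auto
    moreover have "distr M (\<Pi>\<^sub>M i\<in>{..<n}. borel) (?r n) = distr M (L.PP n) (?r n)"
      by (rule distr_cong) (simp_all add: sets_PP)
    ultimately show ?thesis by (simp add: ident)
  qed
  have V_meas [measurable]: "V \<in> borel_measurable M"
    unfolding V_def violation_risk_def by (rule borel_measurable_cond_exp2)
  have law_V: "distr M borel V = ?D" if "0 < N"
  proof -
    \<comment> \<open>\<open>V\<close> is a version of a conditional expectation and thus known only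
      up to null sets, which do not affect its distribution.\<close>
    have "AE \<omega> in M. V \<omega> = L.risk N (?r N \<omega>)"
      using real_cond_exp_eq_risk[OF assms(1) \<open>list_tube P G\<close> P_borel law X, of N]
      by (simp add: V_def violation_risk_def G_def)
    then have "distr M borel V = distr M borel (\<lambda>\<omega>. L.risk N (?r N \<omega>))"
      using measurable_compose[OF r L.measurable_risk] by (intro distr_cong_AE) auto
    also have "\<dots> = distr (distr M (L.PP N) (?r N)) borel (L.risk N)"
      by (subst distr_distr[OF L.measurable_risk r]) (simp add: comp_def)
    finally show ?thesis unfolding law[OF that] .
  qed
  have tail_V: "measure M {\<omega> \<in> space M. V \<omega> > \<epsilon>} = measure ?D {\<epsilon><..}" if "0 < N" for \<epsilon>
    unfolding law_V[OF that, symmetric]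
    by (subst measure_distr) (auto simp: vimage_def Int_def conj_commute)
  have tail_beta: "measure (beta_measure N s) {\<epsilon><..} = binomial_tail N s \<epsilon>"
    if "s \<in> {1..N}" "\<epsilon> \<in> {0..1}" for s \<epsilon>
  proof -
    have "{\<epsilon><..} \<inter> {0<..<1} - {\<epsilon>} = {\<epsilon><..<1}" using that(2) by auto
    from emeasure_beta_greaterThan[OF _ _ _ _ _ this, of s N] that
    have *: "emeasure (beta_measure N s) {\<epsilon><..} = ennreal (binomial_tail N s \<epsilon>)" by simp
    have "0 \<le> binomial_tail N s \<epsilon>"
      unfolding binomial_tail_def using that(2) by (intro sum_nonneg mult_nonneg_nonneg) auto
    then show ?thesis using * by (simp add: measure_def)
  qed
  \<comment> \<open>The tail bound is evaluated at \<open>risk_level\<close>, where the infimum is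
    attained, and complemented. Only an upper bound on the tail is assumed, so both parts of the
    theorem can use this.\<close>
  have level: "measure M {\<omega> \<in> space M. V \<omega> \<le> risk_level N s \<beta>} \<ge> 1 - \<beta>"
    if s: "s \<in> {1..N}" and \<beta>: "\<beta> \<in> {0<..<1}"
      and le: "\<forall>\<epsilon>\<in>{0..1}. measure M {\<omega> \<in> space M. V \<omega> > \<epsilon>} \<le> binomial_tail N s \<epsilon>" for s \<beta>
  proof -
    let ?t = "risk_level N s \<beta>"
    have t: "?t \<in> {0..1}" "binomial_tail N s ?t \<le> \<beta>"
      using binomial_tail_risk_level[of s N \<beta>] s \<beta> by simp_all
    have "measure M {\<omega> \<in> space M. V \<omega> > ?t} \<le> \<beta>"
      by (rule order_trans[OF bspec[OF le t(1)] t(2)])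
    moreover have "measure M {\<omega> \<in> space M. \<not> V \<omega> > ?t} = 1 - measure M {\<omega> \<in> space M. V \<omega> > ?t}"
      by (rule prob_neg) measurable
    ultimately show ?thesis by (simp add: not_less)
  qed
  show ?thesis
  proof (intro conjI ballI impI)
    fix s assume s: "s \<in> {1..N}" and scheme: "proper_boundary_scheme P E A B s"
    have N: "0 < N" using s by simp
    interpret beta: prob_space "beta_measure N s" using s by (intro prob_space_beta) auto
    interpret D: prob_space ?D by (rule L.prob_space_risk)
    have "\<forall>n\<ge>s. AE f in L.PP n. \<forall>I\<subseteq>{..<n}. s \<le> card I \<longrightarrow>
        boundary_equivalence id G B (map f [0..<n]) I \<and> projectivity B (map f [0..<n]) I \<and>
        card (B (map f [0..<n])) = s"
      using scheme by (simp add: proper_boundary_scheme_def boundary_equivalence_def G_def)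
    from L.integral_Bernstein_risk_eq[OF _ _ assms(5) this] s
    have eq: "(\<integral>x. (\<Sum>d\<le>m. g d * Bernstein m d x) \<partial>?D) =
        (\<integral>x. (\<Sum>d\<le>m. g d * Bernstein m d x) \<partial>beta_measure N s)" for m g by simp
    \<comment> \<open>Equality of the Bernstein integrals allows the monotone comparison in both
      directions.\<close>
    have tail: "measure ?D {\<epsilon><..} = measure (beta_measure N s) {\<epsilon><..}" for \<epsilon>
      by (intro antisym measure_greaterThan_mono L.prob_space_risk L.AE_risk_unit AE_beta_unit
          beta.prob_space_axioms) (simp_all add: eq)
    then show tail_eq: "measure M {\<omega> \<in> space M. V \<omega> > \<epsilon>} = binomial_tail N s \<epsilon>" if "\<epsilon> \<in> {0..1}" for \<epsilon>
      using tail_V[OF N] tail_beta[OF s that] by simp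
    then show "measure M {\<omega> \<in> space M. V \<omega> \<le> risk_level N s \<beta>} \<ge> 1 - \<beta>" if "\<beta> \<in> {0<..<1}" for \<beta>
      using level[OF s that] by simp
    \<comment> \<open>The tails agree at every real \<open>\<epsilon>\<close>, also outside the unit
      interval, so the distribution functions agree.\<close>
    have "?D = beta_measure N s"
    proof (rule cdf_unique)
      show "real_distribution ?D"
        by (simp add: real_distribution_def real_distribution_axioms_def D.prob_space_axioms)
      show "real_distribution (beta_measure N s)"
        by (simp add: real_distribution_def real_distribution_axioms_def beta.prob_space_axioms)
      show "cdf ?D = cdf (beta_measure N s)"
      proof
        fix x :: real
        have "UNIV - {..x} = {x<..}" by auto
        then show "cdf ?D x = cdf (beta_measure N s) x"
          using tail[of x] D.prob_compl[of "{..x}"] beta.prob_compl[of "{..x}"]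
          by (simp add: cdf_def)
      qed
    qed
    moreover have "distr M lborel V = distr M borel V" by (rule distr_cong) simp_all
    ultimately show "distributed M lborel V (\<lambda>x. ennreal (beta_density (real s) (real N - real s + 1) x))"
      using law_V[OF N] by (simp add: distributed_def)
  next
    fix s assume s: "s \<in> {1..N}" and scheme: "certified_boundary_complexity P E A B s"
    have N: "0 < N" using s by simp
    have "\<forall>n\<ge>s. AE f in L.PP n. \<forall>I\<subseteq>{..<n}. s \<le> card I \<longrightarrow>
        boundary_equivalence id G B (map f [0..<n]) I \<and> projectivity B (map f [0..<n]) I"
      and "\<forall>T. card (B T) \<le> s"
      using scheme by (simp_all add: certified_boundary_complexity_def boundary_equivalence_def G_def)
    from L.integral_Bernstein_risk_le[OF _ _ assms(5) _ this] s
    have "measure ?D {\<epsilon><..} \<le> measure (beta_measure N s) {\<epsilon><..}" for \<epsilon>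
      by (intro measure_greaterThan_mono L.prob_space_risk L.AE_risk_unit AE_beta_unit prob_space_beta) auto
    then show tail_le: "measure M {\<omega> \<in> space M. V \<omega> > \<epsilon>} \<le> binomial_tail N s \<epsilon>" if "\<epsilon> \<in> {0..1}" for \<epsilon>
      using tail_V[OF N] tail_beta[OF s that] by (metis)
    then show "measure M {\<omega> \<in> space M. V \<omega> \<le> risk_level N s \<beta>} \<ge> 1 - \<beta>" if "\<beta> \<in> {0<..<1}" for \<beta>
      using level[OF s that] by blast
  qed
qed

end
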